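(* Let $f:\mathbb{R}^n\to\mathbb{R}$ be continuously differentiable, convex, with global minimum value $f_{\mathrm{low}}:=\min_{x\in\mathbb{R}^n}f(x)$ attained at a minimizer $x^*$, and assume there exists $R\ge1$ such that $\|x-x^*\|\le R$ for all $x$ with $f(x)\le f(x_0)$. Consider a run of the trust-region algorithm described in the context. Assume there is $L\ge 1$ with $|f(x_k+s_k)-m_k(s_k)|\le \tfrac12(L+\|B_k\|)\|s_k\|^2$ for all $k\in\mathbb{N}$, and that there exist $\mu>0$ and $0<p\le 1$ such that $\max_{j=0,\ldots,k}\|B_j\|\le \mu(1+k^p)$ for all $k\in\mathbb{N}$. Assume that the algorithm generates infinitely many successful iterations. Let $\tau$ be a positive integer such that $\gamma_4\gamma_2^{\tau-1}<1$, let $\xi:=\sum_{k\in\mathbb{N}}(\gamma_4\gamma_2^{\tau-1})^{k/\tau}$, and let $$\kappa_0:=\frac{\psi_\beta(2\mu)}{\eta_1\kappa_{\mathrm{mdc}}a_{\min}},\qquad \kappa_3:=\psi_\beta(2\mu)\,\xi,\qquad \kappa_4:=\log_{\gamma_2}\left(\frac{a_{\min}}{\Delta_0}\right)+1.$$ Let $\delta_k:=f(x_k)-f_{\mathrm{low}}$, let $\epsilon>0$, and let $\widehat{k}_\epsilon$ be the first iteration such that $\delta_{\widehat{k}_\epsilon}>\epsilon$ and $\delta_{\widehat{k}_\epsilon+1}\le\epsilon$. If $0<p<1$, then $$\widehat{k}_\epsilon\le\left[(1-p)\left(\tau R^2\kappa_0\,\epsilon^{-1}+\kappa_3\right)+\left((1-\alpha)\log_{\gamma_2}(\epsilon)+\kappa_4\right)^{1-p}\right]^{1/(1-p)}=O\left([(1-p)\epsilon^{-1}]^{1/(1-p)}\right).$$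 If $p=1$, then $$\widehat{k}_\epsilon\le\left((1-\alpha)\log_{\gamma_2}(\epsilon)+\kappa_4\right)\exp\left(\tau R^2\kappa_0\,\epsilon^{-1}+\kappa_3\right).$$
   Context: $\|\cdot\|$ is the Euclidean norm for vectors and the induced norm for matrices; $\mathbb{N}=\{0,1,2,\ldots\}$; by convention $0^0=1$. Trust-region algorithm. Fix constants $0<\eta_1\le\eta_2<1$, $0<\gamma_1\le\gamma_2<1\le\gamma_3\le\gamma_4$, $0<\kappa_{\mathrm{mdc}}\le\frac12$, $-1\le\alpha\le1$, $0\le\beta\le1$, $x_0\in\mathbb{R}^n$, $\Delta_0>0$. For $k=0,1,\ldots$: choose a symmetric $B_k\in\mathbb{R}^{n\times n}$ and set $m_k(s):=f(x_k)+\nabla f(x_k)^Ts+\frac12 s^TB_ks$ and $r_k:=\frac{\|\nabla f(x_k)\|^\alpha}{(1+\|B_k\|)^\beta}\Delta_k$. Let $s_{k,\mathrm{cp}}:=-t_k\nabla f(x_k)$, where $t_k$ minimizes $m_k(-t\nabla f(x_k))$ over $t\ge0$ with $\|t\nabla f(x_k)\|\le r_k$. Compute any $s_k$ with $\|s_k\|\le r_k$ and $m_k(0)-m_k(s_k)\ge2\kappa_{\mathrm{mdc}}(m_k(0)-m_k(s_{k,\mathrm{cp}}))$. Let $\rho_k:=\frac{f(x_k)-f(x_k+s_k)}{m_k(0)-m_k(s_k)}$. If $\rho_k\ge\eta_1$, set $x_{k+1}:=x_k+s_k$; otherwise $x_{k+1}:=x_k$. Choose $\Delta_{k+1}\in[\gamma_3\Delta_k,\gamma_4\Delta_k]$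 if $\rho_k\ge\eta_2$; $\Delta_{k+1}\in[\gamma_2\Delta_k,\Delta_k]$ if $\eta_1\le\rho_k<\eta_2$; $\Delta_{k+1}\in[\gamma_1\Delta_k,\gamma_2\Delta_k]$ if $\rho_k<\eta_1$. Iteration $k$ is successful if $\rho_k\ge\eta_1$. $a_{\min}:=2\gamma_1\kappa_{\mathrm{mdc}}(1-\eta_2)\min\left\{1,\frac{\Delta_0}{\|\nabla f(x_0)\|^{1-\alpha}}\right\}$. For $x\ge0$, $\psi_\beta(x):=L+x$ if $\beta\in[0,1/L]$ and $\psi_\beta(x):=L(1+x)$ if $\beta\in(1/L,1]$. $\log_{\gamma_2}$ is the logarithm in base $\gamma_2$. The $O(\cdot)$ notation refers to $\epsilon\to0$.
   Formalization: The displayed bounds fail for some ε when R>1 and α<1 (their right side can even be negative or undefined); they are proved for all sufficiently small ε>0 (depending on the run), and for every ε>0 with log_{γ2}(ε) replaced by log_{γ2}(ε/R). *)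

theory Defs
  imports "HOL-Analysis.Analysis" "HOL-Library.Landau_Symbols"
begin

(* Euclidean-induced operator norm; the type-class norm on real^'n^'n is the Frobenius norm. *)
definition opnorm :: "real^'n^'n \<Rightarrow> real" where
  "opnorm A = onorm (\<lambda>v. A *v v)"

(* Real powers of nonnegative reals with 0^0 = 1, whereas 0 powr 0 = 0. *)
definition rpow :: "real \<Rightarrow> real \<Rightarrow> real" where
  "rpow b a = (if b = 0 \<and> a = 0 then 1 else b powr a)"

(* Here and below, g is the gradient of f. *)
definition tr_model ::
  "(real^'n \<Rightarrow> real) \<Rightarrow> (real^'n \<Rightarrow> real^'n) \<Rightarrow> real^'n^'n \<Rightarrow> real^'n \<Rightarrow> real^'n \<Rightarrow> real" where
  "tr_model f g B x s = f x + g x \<bullet> s + (1/2) * (s \<bullet> (B *v s))"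

definition tr_radius ::
  "real \<Rightarrow> real \<Rightarrow> (real^'n \<Rightarrow> real^'n) \<Rightarrow> real^'n^'n \<Rightarrow> real^'n \<Rightarrow> real \<Rightarrow> real" where
  "tr_radius \<alpha> \<beta> g B x \<Delta> = rpow (norm (g x)) \<alpha> / (1 + opnorm B) powr \<beta> * \<Delta>"

(* The ratio is 0/0 = 0 when the model decrease vanishes. *)
definition tr_ratio ::
  "(real^'n \<Rightarrow> real) \<Rightarrow> (real^'n \<Rightarrow> real^'n) \<Rightarrow> real^'n^'n \<Rightarrow> real^'n \<Rightarrow> real^'n \<Rightarrow> real" where
  "tr_ratio f g B x s =
     (f x - f (x + s)) / (tr_model f g B x 0 - tr_model f g B x s)"

definition tr_params ::
  "real \<Rightarrow> real \<Rightarrow> real \<Rightarrow> real \<Rightarrow> real \<Rightarrow> real \<Rightarrow> real \<Rightarrow> real \<Rightarrow> real \<Rightarrow> bool" where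
  "tr_params \<eta>\<^sub>1 \<eta>\<^sub>2 \<gamma>\<^sub>1 \<gamma>\<^sub>2 \<gamma>\<^sub>3 \<gamma>\<^sub>4 \<kappa> \<alpha> \<beta> \<longleftrightarrow>
     0 < \<eta>\<^sub>1 \<and> \<eta>\<^sub>1 \<le> \<eta>\<^sub>2 \<and> \<eta>\<^sub>2 < 1 \<and>
     0 < \<gamma>\<^sub>1 \<and> \<gamma>\<^sub>1 \<le> \<gamma>\<^sub>2 \<and> \<gamma>\<^sub>2 < 1 \<and> 1 \<le> \<gamma>\<^sub>3 \<and> \<gamma>\<^sub>3 \<le> \<gamma>\<^sub>4 \<and>
     0 < \<kappa> \<and> \<kappa> \<le> 1/2 \<and> -1 \<le> \<alpha> \<and> \<alpha> \<le> 1 \<and> 0 \<le> \<beta> \<and> \<beta> \<le> 1"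

(* The sequences x, \<Delta>, B, t, s form a run started at x 0 with radius parameter \<Delta> 0;
   t k is the Cauchy step length and s k the trial step. *)
definition tr_run ::
  "real \<Rightarrow> real \<Rightarrow> real \<Rightarrow> real \<Rightarrow> real \<Rightarrow> real \<Rightarrow> real \<Rightarrow> real \<Rightarrow> real \<Rightarrow>
   (real^'n \<Rightarrow> real) \<Rightarrow> (real^'n \<Rightarrow> real^'n) \<Rightarrow>
   (nat \<Rightarrow> real^'n) \<Rightarrow> (nat \<Rightarrow> real) \<Rightarrow> (nat \<Rightarrow> real^'n^'n) \<Rightarrow> (nat \<Rightarrow> real) \<Rightarrow> (nat \<Rightarrow> real^'n) \<Rightarrow> bool" where
  "tr_run \<eta>\<^sub>1 \<eta>\<^sub>2 \<gamma>\<^sub>1 \<gamma>\<^sub>2 \<gamma>\<^sub>3 \<gamma>\<^sub>4 \<kappa> \<alpha> \<beta> f g x \<Delta> B t s \<longleftrightarrow>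
     0 < \<Delta> 0 \<and>
     (\<forall>k. let m = tr_model f g (B k) (x k);
              r = tr_radius \<alpha> \<beta> g (B k) (x k) (\<Delta> k);
              \<rho> = tr_ratio f g (B k) (x k) (s k)
          in transpose (B k) = B k \<and>
             is_arg_min (\<lambda>u. m (- (u *\<^sub>R g (x k)))) (\<lambda>u. 0 \<le> u \<and> norm (u *\<^sub>R g (x k)) \<le> r) (t k) \<and>
             norm (s k) \<le> r \<and>
             m 0 - m (s k) \<ge> 2 * \<kappa> * (m 0 - m (- (t k *\<^sub>R g (x k)))) \<and>
             x (Suc k) = (if \<rho> \<ge> \<eta>\<^sub>1 then x k + s k else x k) \<and>
             (\<rho> \<ge> \<eta>\<^sub>2 \<longrightarrow> \<Delta> (Suc k) \<in> {\<gamma>\<^sub>3 * \<Delta> k..\<gamma>\<^sub>4 * \<Delta> k}) \<and>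
             (\<eta>\<^sub>1 \<le> \<rho> \<and> \<rho> < \<eta>\<^sub>2 \<longrightarrow> \<Delta> (Suc k) \<in> {\<gamma>\<^sub>2 * \<Delta> k..\<Delta> k}) \<and>
             (\<rho> < \<eta>\<^sub>1 \<longrightarrow> \<Delta> (Suc k) \<in> {\<gamma>\<^sub>1 * \<Delta> k..\<gamma>\<^sub>2 * \<Delta> k}))"

definition psi :: "real \<Rightarrow> real \<Rightarrow> real \<Rightarrow> real" where
  "psi L \<beta> x = (if \<beta> \<le> 1 / L then L + x else L * (1 + x))"

definition first_crossing :: "(nat \<Rightarrow> real) \<Rightarrow> real \<Rightarrow> nat \<Rightarrow> bool" where
  "first_crossing \<delta> \<epsilon> k \<longleftrightarrow>
     \<delta> k > \<epsilon> \<and> \<delta> (Suc k) \<le> \<epsilon> \<and> (\<forall>j<k. \<not> (\<delta> j > \<epsilon> \<and> \<delta> (Suc j) \<le> \<epsilon>))"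

end

theory Submission
  imports Defs
begin

text \<open>
  As long as the optimality gap \<open>\<delta>\<close> exceeds \<open>\<epsilon>\<close>, convexity and the bounded level set keep the
  gradient norm above \<open>\<epsilon> / R\<close> (\<open>gap_le_grad_norm\<close>). Put \<open>M k = \<mu> * (1 + k powr p)\<close> and call
  \<open>1 / psi L \<beta> (M k)\<close>, which does not increase with \<open>k\<close>, the weight of iteration \<open>k\<close>.

  A small radius makes an iteration very successful, so the radius cannot become small: it stays
  above \<open>a_min * (\<epsilon> / R) powr (1 - \<alpha>)\<close> times the weight (\<open>Delta_lower_bound\<close>). Consequently each
  successful iteration lowers the gap by at least a constant multiple of its square times the
  weight, and so it raises \<open>1 / \<delta>\<close> by at least a constant multiple of the weight. Since \<open>1 / \<delta>\<close>
  stays below \<open>1 / \<epsilon>\<close>, the weights of the successful iterations have a sum of order \<open>1 / \<epsilon>\<close>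
  (\<open>sum_successful_le\<close>).

  Unsuccessful iterations are controlled by the radius (\<open>sum_tail_le\<close>). After an initial phase of
  about \<open>(1 - \<alpha>) * log \<gamma>\<^sub>2 (\<epsilon> / R) + \<kappa>\<^sub>4\<close> iterations, the iteration \<open>i\<close> places further on falls
  under one of two cases. If more than \<open>i / \<tau>\<close> successful ones precede it, its weight is charged to
  a successful iteration, and every successful iteration is charged at most \<open>\<tau>\<close> times. Otherwise the
  radius is geometrically small, and by its lower bound so is the weight; these weights contribute
  at most \<open>\<xi>\<close>. The weight of iteration \<open>k \<ge> 1\<close> is at least \<open>k powr - p / psi L \<beta> (2 * \<mu>)\<close>, so the
  sum of \<open>k powr - p\<close> from the end of the initial phase to the crossing is bounded, and comparison
  with an integral bounds the crossing index.

  This argument produces \<open>log \<gamma>\<^sub>2 (\<epsilon> / R)\<close>, which exceeds \<open>log \<gamma>\<^sub>2 \<epsilon>\<close> by a constant if \<open>R > 1\<close>. It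
  also produces \<open>1 / \<epsilon> - 1 / \<delta> 0\<close> in place of \<open>1 / \<epsilon>\<close>, and this constant gain dominates the effect
  of the shift once \<open>\<epsilon>\<close> is small, because the logarithm, unless its factor \<open>1 - \<alpha>\<close> vanishes, tends
  to infinity and enters through a concave function: a power with exponent \<open>1 - p\<close> below 1, or \<open>ln\<close>
  in the exponent when \<open>p = 1\<close>.
\<close>

section \<open>Real powers and sums of powers\<close>

text \<open>
  Bernoulli's inequality for exponents in the unit interval. It drives the comparison of power sums with
  integrals, the monotonicity of the radius bound and the asymptotic comparison as \<open>\<epsilon>\<close> tends to 0.
\<close>

lemma powr_le_affine:
  fixes a y :: real
  assumes "0 < y" "0 \<le> a" "a \<le> 1"
  shows "y powr a \<le> 1 + a * (y - 1)"
  using Youngs_inequality_0[of a "1 - a" y 1] assms by (simp add: algebra_simps)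

lemma powr_increment_le:
  fixes y d q :: real
  assumes "0 < y" "0 \<le> d" "0 \<le> q" "q \<le> 1"
  shows "(y + d) powr q \<le> y powr q + q * d * y powr (q - 1)"
proof -
  have "(y + d) powr q = (y * (1 + d / y)) powr q"
    using assms by (simp add: distrib_left)
  also have "\<dots> = y powr q * (1 + d / y) powr q"
    using assms by (intro powr_mult)
  also have "\<dots> \<le> y powr q * (1 + q * (d / y))"
  proof (rule mult_left_mono)
    show "(1 + d / y) powr q \<le> 1 + q * (d / y)"
      using powr_le_affine[of "1 + d / y" q] assms by (simp add: add_pos_nonneg)
  qed simp
  also have "\<dots> = y powr q + q * d * y powr (q - 1)"
    using assms by (simp add: powr_diff field_simps)
  finally show ?thesis .
qed

text \<open>
  The comparison of a sum with \<open>\<integral> t powr - p\<close>, done by telescoping: one increment of the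
  antiderivative is bounded by the concavity of \<open>t powr (1 - p)\<close>.
\<close>

lemma sum_powr_ge_powr_diff:
  fixes p :: real and n m :: nat
  assumes "0 \<le> p" "p \<le> 1" "1 \<le> n" "n \<le> m"
  shows "real m powr (1 - p) - real n powr (1 - p) \<le> (1 - p) * (\<Sum>k=n..<m. real k powr - p)"
  using \<open>n \<le> m\<close>
proof (induction m rule: dec_induct)
  case (step k)
  have "(real k + 1) powr (1 - p) \<le> real k powr (1 - p) + (1 - p) * 1 * real k powr (1 - p - 1)"
    using assms step by (intro powr_increment_le) auto
  then show ?case
    using step by (simp add: algebra_simps)
qed simp

lemma sum_inverse_ge_ln_diff:
  fixes n m :: nat
  assumes "1 \<le> n" "n \<le> m"
  shows "ln (real m) - ln (real n) \<le> (\<Sum>k=n..<m. 1 / real k)"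
  using \<open>n \<le> m\<close>
proof (induction m rule: dec_induct)
  case (step k)
  have "ln (1 + 1 / real k) \<le> 1 / real k"
    by (rule ln_add_one_self_le_self) simp
  moreover have "1 + 1 / real k = real (Suc k) / real k"
    using assms step by (simp add: field_simps)
  then have "ln (1 + 1 / real k) = ln (real (Suc k)) - ln (real k)"
    using assms step by (simp only: ln_div) simp
  ultimately show ?case
    using step by simp
qed simp

text \<open>
  The worst radius after \<open>i\<close> iterations of which at most a fraction \<open>1 / \<tau>\<close> succeed: the bound is the
  left-hand side at the real number of successes \<open>i / \<tau>\<close>, and the left-hand side does not
  decrease with \<open>S\<close> because every success trades a factor \<open>b \<le> 1\<close> for a factor \<open>a \<ge> 1\<close>.
\<close>

lemma power_mult_power_le_powr:
  fixes a b :: real and S i \<tau> :: nat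
  assumes "1 \<le> a" "0 < b" "b \<le> 1" "0 < \<tau>" "\<tau> * S \<le> i"
  shows "a ^ S * b ^ (i - S) \<le> (a * b ^ (\<tau> - 1)) powr (real i / real \<tau>)"
proof -
  let ?q = "real i / real \<tau>"
  have S: "real S \<le> ?q"
    using assms by (simp add: field_simps flip: of_nat_mult)
  have "S \<le> i"
    using assms by (metis le_trans mult_le_mono1 nat_mult_1 Suc_leI One_nat_def)
  have "?q * real (\<tau> - 1) = real i - ?q"
    using assms by (simp add: of_nat_diff field_simps)
  also have "\<dots> \<le> real (i - S)"
    using S \<open>S \<le> i\<close> by (simp add: of_nat_diff)
  finally have "b powr real (i - S) \<le> b powr (?q * real (\<tau> - 1))"
    using assms by (intro powr_mono') auto
  also have "\<dots> = (b ^ (\<tau> - 1)) powr ?q"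
    using assms by (simp add: powr_powr mult.commute flip: powr_realpow)
  finally have "b powr real (i - S) \<le> (b ^ (\<tau> - 1)) powr ?q" .
  moreover have "a powr real S \<le> a powr ?q"
    using assms S by (intro powr_mono) auto
  ultimately have "a powr real S * b powr real (i - S) \<le> a powr ?q * (b ^ (\<tau> - 1)) powr ?q"
    by (intro mult_mono) auto
  then show ?thesis
    using assms by (simp add: powr_mult powr_realpow)
qed

lemma summable_powr_divide:
  fixes \<theta> :: real and \<tau> :: nat
  assumes "0 < \<theta>" "\<theta> < 1" "0 < \<tau>"
  shows "summable (\<lambda>k::nat. \<theta> powr (real k / real \<tau>))"
proof -
  have "(\<lambda>k::nat. \<theta> powr (real k / real \<tau>)) = (\<lambda>k. (\<theta> powr (1 / real \<tau>)) ^ k)"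
    using assms by (simp add: powr_powr powr_realpow[symmetric])
  moreover have "\<theta> powr (1 / real \<tau>) < 1"
    using assms powr_less_mono2[of "1 / real \<tau>" \<theta> 1] by simp
  ultimately show ?thesis
    by (simp add: summable_geometric)
qed

section \<open>Convexity, the operator norm and the function psi\<close>

lemma convex_on_gradient_above_tangent:
  fixes f :: "'a::real_inner \<Rightarrow> real"
  assumes "convex_on UNIV f" and grad: "GDERIV f y :> d"
  shows "f y + d \<bullet> (z - y) \<le> f z"
proof -
  let ?h = "\<lambda>u::real. f (y + u *\<^sub>R (z - y))"
  have "convex_on UNIV ?h"
  proof (rule convex_onI)
    fix r u v :: real
    assume "0 < r" "r < 1"
    have "y + ((1 - r) *\<^sub>R u + r *\<^sub>R v) *\<^sub>R (z - y)
        = (1 - r) *\<^sub>R (y + u *\<^sub>R (z - y)) + r *\<^sub>R (y + v *\<^sub>R (z - y))"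
      by (simp add: algebra_simps)
    then show "?h ((1 - r) *\<^sub>R u + r *\<^sub>R v) \<le> (1 - r) * ?h u + r * ?h v"
      using convex_onD[OF assms(1), of r "y + u *\<^sub>R (z - y)" "y + v *\<^sub>R (z - y)"]
        \<open>0 < r\<close> \<open>r < 1\<close> by simp
  qed simp
  moreover have "(?h has_real_derivative d \<bullet> (z - y)) (at 0 within UNIV)"
  proof -
    have "(f has_derivative (\<lambda>h. h \<bullet> d)) (at (y + 0 *\<^sub>R (z - y)))"
      using grad by (simp add: gderiv_def)
    moreover have "((\<lambda>u. y + u *\<^sub>R (z - y)) has_derivative (\<lambda>u. u *\<^sub>R (z - y))) (at 0)"
      by (auto intro!: derivative_eq_intros)
    ultimately have "(?h has_derivative (\<lambda>u. (u *\<^sub>R (z - y)) \<bullet> d)) (at 0)"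
      using has_derivative_compose by blast
    moreover have "(\<lambda>u. (u *\<^sub>R (z - y)) \<bullet> d) = (*) (d \<bullet> (z - y))"
      by (simp add: fun_eq_iff inner_commute mult.commute)
    ultimately show ?thesis
      by (simp add: has_field_derivative_def)
  qed
  ultimately have "d \<bullet> (z - y) * (1 - 0) \<le> ?h 1 - ?h 0"
    by (intro convex_on_imp_above_tangent) auto
  then show ?thesis by simp
qed

lemma psi_ge: "L \<ge> 1 \<Longrightarrow> 0 \<le> y \<Longrightarrow> L + y \<le> psi L \<beta> y"
  by (simp add: psi_def algebra_simps mult_le_cancel_right1)

lemma psi_mono: "L \<ge> 1 \<Longrightarrow> y \<le> z \<Longrightarrow> psi L \<beta> y \<le> psi L \<beta> z"
  by (simp add: psi_def)

lemma psi_mult_le: "L \<ge> 1 \<Longrightarrow> 1 \<le> c \<Longrightarrow> psi L \<beta> (y * c) \<le> psi L \<beta> y * c"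
  by (simp add: psi_def algebra_simps)

text \<open>
  The two branches of \<open>psi\<close> serve this monotonicity. The function \<open>(1 + y) powr \<beta> / (L + y)\<close>
  is nonincreasing on the nonnegative reals when \<open>\<beta> * L \<le> 1\<close>, but for larger \<open>\<beta>\<close> it increases near zero;
  replacing \<open>L + y\<close> by the larger \<open>L * (1 + y)\<close> restores monotonicity. With \<open>q\<close> the ratio
  \<open>(1 + z) / (1 + y)\<close>, Bernoulli's inequality reduces the claim to a linear one.
\<close>

lemma powr_div_psi_antimono:
  assumes "L \<ge> 1" "0 \<le> \<beta>" "\<beta> \<le> 1" "0 \<le> y" "y \<le> z"
  shows "(1 + z) powr \<beta> / psi L \<beta> z \<le> (1 + y) powr \<beta> / psi L \<beta> y"
proof -
  define q where "q = (1 + z) / (1 + y)"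
  have q: "0 < q" "1 + z = (1 + y) * q" "q - 1 = (z - y) / (1 + y)"
    using assms by (auto simp: q_def field_simps)
  have pos: "0 < psi L \<beta> y" "0 < psi L \<beta> z"
    using psi_ge[of L y \<beta>] psi_ge[of L z \<beta>] assms by auto
  have "q powr \<beta> \<le> 1 + \<beta> * (q - 1)"
    using q assms by (intro powr_le_affine)
  also have "\<dots> \<le> psi L \<beta> z / psi L \<beta> y"
  proof (cases "\<beta> \<le> 1 / L")
    case True
    have "\<beta> * L \<le> 1"
      using True assms by (simp add: field_simps)
    moreover have "\<beta> * y \<le> y"
      using assms by (simp add: mult_left_le_one_le)
    ultimately have "\<beta> * (L + y) \<le> 1 + y"
      by (simp add: distrib_left)
    then have "\<beta> / (1 + y) \<le> 1 / (L + y)"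
      using assms by (simp add: field_simps)
    then have "\<beta> / (1 + y) * (z - y) \<le> 1 / (L + y) * (z - y)"
      using assms by (intro mult_right_mono) auto
    moreover have "psi L \<beta> z / psi L \<beta> y = 1 + 1 / (L + y) * (z - y)"
      using True assms by (simp add: psi_def field_simps)
    ultimately show ?thesis
      using q by simp
  next
    case False
    have "\<beta> * (q - 1) \<le> 1 * (q - 1)"
      using assms q by (intro mult_right_mono) auto
    then show ?thesis
      using False assms by (simp add: psi_def q_def)
  qed
  finally have "q powr \<beta> \<le> psi L \<beta> z / psi L \<beta> y" .
  then have "(1 + y) powr \<beta> * q powr \<beta> \<le> (1 + y) powr \<beta> * (psi L \<beta> z / psi L \<beta> y)"
    by (intro mult_left_mono) auto
  then have "(1 + z) powr \<beta> \<le> (1 + y) powr \<beta> * (psi L \<beta> z / psi L \<beta> y)"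
    using q assms by (simp add: powr_mult)
  then show ?thesis
    using pos by (simp add: field_simps)
qed

lemma opnorm_nonneg: "0 \<le> opnorm A"
  unfolding opnorm_def by (rule onorm_pos_le) simp

lemma quadratic_form_le_opnorm: "v \<bullet> (A *v v) \<le> opnorm A * (norm v)\<^sup>2"
proof -
  have "v \<bullet> (A *v v) \<le> norm v * norm (A *v v)"
    by (rule norm_cauchy_schwarz)
  also have "\<dots> \<le> norm v * (opnorm A * norm v)"
    unfolding opnorm_def by (intro mult_left_mono onorm) auto
  finally show ?thesis by (simp add: power2_eq_square algebra_simps)
qed

lemma rpow_pos: "0 < y \<Longrightarrow> 0 < rpow y a"
  by (simp add: rpow_def)

section \<open>Sums over dense sets of indices\<close>

text \<open>The counting function of \<open>S\<close> increases in unit steps, so it takes every intermediate value, and it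
  leaves a value exactly at an element of \<open>S\<close>.\<close>

lemma exists_member_of_rank:
  fixes S :: "nat set"
  assumes "q < card (S \<inter> {..<n})"
  obtains j where "j \<in> S" "j < n" "card (S \<inter> {..<j}) = q"
proof -
  have "\<exists>j\<in>S. j < n \<and> card (S \<inter> {..<j}) = q"
    using assms
  proof (induction n)
    case (Suc n)
    show ?case
    proof (cases "q < card (S \<inter> {..<n})")
      case True
      then show ?thesis using Suc.IH less_SucI by blast
    next
      case False
      then show ?thesis
        using Suc.prems by (auto simp: lessThan_Suc Int_insert_right split: if_splits)
    qed
  qed simp
  then show ?thesis using that by blast
qed

text \<open>
  If more than \<open>i / \<tau>\<close> elements of \<open>S\<close> lie below \<open>n + i\<close>, then the element of rank \<open>i div \<tau>\<close> is
  one of them, and it carries a value of \<open>a\<close> at least \<open>a (n + i)\<close>. Sending \<open>i\<close> to that element uses every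
  element of \<open>S\<close> at most \<open>\<tau>\<close> times, once for each remainder of \<open>i\<close> modulo \<open>\<tau>\<close>.
\<close>

lemma sum_le_sum_on_dense_set:
  fixes a :: "nat \<Rightarrow> real" and S :: "nat set"
  assumes "antimono a" and nonneg: "\<And>k. 0 \<le> a k" and "0 < \<tau>"
    and I: "\<And>i. i \<in> I \<Longrightarrow> i \<le> N \<and> i < \<tau> * card (S \<inter> {..<n + i})"
  shows "(\<Sum>i\<in>I. a (n + i)) \<le> real \<tau> * (\<Sum>j \<in> S \<inter> {..<n + N}. a j)"
proof -
  let ?rank = "\<lambda>j. card (S \<inter> {..<j})"
  have "finite I"
    using I finite_subset[of I "{..N}"] by blast
  have "(\<Sum>i\<in>I. a (n + i)) \<le> (\<Sum>(j, r) \<in> (S \<inter> {..<n + N}) \<times> {..<\<tau>}. a j)"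
  proof (rule sum_le_included[where i = "\<lambda>(j, r). \<tau> * ?rank j + r"])
    show "\<forall>i\<in>I. \<exists>jr\<in>(S \<inter> {..<n + N}) \<times> {..<\<tau>}.
        (case jr of (j, r) \<Rightarrow> \<tau> * ?rank j + r) = i \<and> a (n + i) \<le> (case jr of (j, r) \<Rightarrow> a j)"
    proof
      fix i assume "i \<in> I"
      then have i: "i \<le> N" "i div \<tau> < ?rank (n + i)"
        using I[of i] \<open>0 < \<tau>\<close> by (auto simp: less_mult_imp_div_less mult.commute)
      obtain j where j: "j \<in> S" "j < n + i" "?rank j = i div \<tau>"
        using i exists_member_of_rank by blast
      have "a (n + i) \<le> a j"
        using \<open>antimono a\<close> j by (simp add: antimonoD)
      with i j \<open>0 < \<tau>\<close> show "\<exists>jr\<in>(S \<inter> {..<n + N}) \<times> {..<\<tau>}.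
          (case jr of (j, r) \<Rightarrow> \<tau> * ?rank j + r) = i \<and> a (n + i) \<le> (case jr of (j, r) \<Rightarrow> a j)"
        by (intro bexI[of _ "(j, i mod \<tau>)"]) auto
    qed
  qed (use \<open>finite I\<close> nonneg in auto)
  also have "\<dots> = real \<tau> * (\<Sum>j \<in> S \<inter> {..<n + N}. a j)"
    by (simp add: sum.cartesian_product[symmetric] sum_distrib_left)
  finally show ?thesis .
qed

section \<open>Runs of the algorithm on a convex function\<close>

text \<open>
  The Hessian approximations enter only through a nondecreasing majorant \<open>M\<close> of their norms; its growth in
  \<open>k\<close> matters at the very end, when the weights \<open>1 / psi L \<beta> (M k)\<close> are compared with \<open>k powr - p\<close>.
\<close>

locale convex_trust_region_run =
  fixes f :: "real^'n \<Rightarrow> real" and g :: "real^'n \<Rightarrow> real^'n" and xstar :: "real^'n"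
    and x s :: "nat \<Rightarrow> real^'n" and \<Delta> t :: "nat \<Rightarrow> real" and B :: "nat \<Rightarrow> real^'n^'n"
    and \<eta>\<^sub>1 \<eta>\<^sub>2 \<gamma>\<^sub>1 \<gamma>\<^sub>2 \<gamma>\<^sub>3 \<gamma>\<^sub>4 \<kappa> \<alpha> \<beta> R L :: real and M :: "nat \<Rightarrow> real"
  assumes gradient: "GDERIV f y :> g y" and convex: "convex_on UNIV f"
    and minimizer: "f xstar \<le> f y"
    and R_ge_1: "R \<ge> 1" and level_set: "f y \<le> f (x 0) \<Longrightarrow> norm (y - xstar) \<le> R"
    and params: "tr_params \<eta>\<^sub>1 \<eta>\<^sub>2 \<gamma>\<^sub>1 \<gamma>\<^sub>2 \<gamma>\<^sub>3 \<gamma>\<^sub>4 \<kappa> \<alpha> \<beta>"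
    and run: "tr_run \<eta>\<^sub>1 \<eta>\<^sub>2 \<gamma>\<^sub>1 \<gamma>\<^sub>2 \<gamma>\<^sub>3 \<gamma>\<^sub>4 \<kappa> \<alpha> \<beta> f g x \<Delta> B t s"
    and L_ge_1: "L \<ge> 1"
    and model_error: "\<bar>f (x k + s k) - tr_model f g (B k) (x k) (s k)\<bar>
              \<le> 1/2 * (L + opnorm (B k)) * (norm (s k))\<^sup>2"
    and mono_M: "mono M" and opnorm_le_M: "opnorm (B k) \<le> M k"
begin

abbreviation grad_norm :: "nat \<Rightarrow> real" where "grad_norm k \<equiv> norm (g (x k))"
abbreviation \<rho> :: "nat \<Rightarrow> real" where "\<rho> k \<equiv> tr_ratio f g (B k) (x k) (s k)"
abbreviation gap :: "nat \<Rightarrow> real" where "gap k \<equiv> f (x k) - f xstar"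
abbreviation successful :: "nat set" where "successful \<equiv> {k. \<eta>\<^sub>1 \<le> \<rho> k}"
abbreviation model_decrease :: "nat \<Rightarrow> real" where
  "model_decrease k \<equiv> tr_model f g (B k) (x k) 0 - tr_model f g (B k) (x k) (s k)"
abbreviation radius :: "nat \<Rightarrow> real" where
  "radius k \<equiv> tr_radius \<alpha> \<beta> g (B k) (x k) (\<Delta> k)"

definition a_min :: real where
  "a_min = 2 * \<gamma>\<^sub>1 * \<kappa> * (1 - \<eta>\<^sub>2) * min 1 (\<Delta> 0 / rpow (grad_norm 0) (1 - \<alpha>))"

lemma eta: "0 < \<eta>\<^sub>1" "\<eta>\<^sub>1 \<le> \<eta>\<^sub>2" "\<eta>\<^sub>2 < 1"
  and gamma: "0 < \<gamma>\<^sub>1" "\<gamma>\<^sub>1 \<le> \<gamma>\<^sub>2" "\<gamma>\<^sub>2 < 1" "1 \<le> \<gamma>\<^sub>3" "\<gamma>\<^sub>3 \<le> \<gamma>\<^sub>4"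
  and kappa: "0 < \<kappa>" "\<kappa> \<le> 1/2"
  and alpha: "-1 \<le> \<alpha>" "\<alpha> \<le> 1"
  and beta: "0 \<le> \<beta>" "\<beta> \<le> 1"
  using params by (auto simp: tr_params_def)

lemma run_step:
  shows cauchy_minimal:
      "is_arg_min (\<lambda>u. tr_model f g (B k) (x k) (- (u *\<^sub>R g (x k))))
         (\<lambda>u. 0 \<le> u \<and> norm (u *\<^sub>R g (x k)) \<le> radius k) (t k)"
    and step_le_radius: "norm (s k) \<le> radius k"
    and sufficient_decrease: "model_decrease k \<ge> 2 * \<kappa> *
          (tr_model f g (B k) (x k) 0 - tr_model f g (B k) (x k) (- (t k *\<^sub>R g (x k))))"
    and iterate_Suc: "x (Suc k) = (if \<rho> k \<ge> \<eta>\<^sub>1 then x k + s k else x k)"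
    and radius_very_successful: "\<rho> k \<ge> \<eta>\<^sub>2 \<Longrightarrow> \<Delta> (Suc k) \<in> {\<gamma>\<^sub>3 * \<Delta> k..\<gamma>\<^sub>4 * \<Delta> k}"
    and radius_successful: "\<eta>\<^sub>1 \<le> \<rho> k \<Longrightarrow> \<rho> k < \<eta>\<^sub>2 \<Longrightarrow> \<Delta> (Suc k) \<in> {\<gamma>\<^sub>2 * \<Delta> k..\<Delta> k}"
    and radius_unsuccessful: "\<rho> k < \<eta>\<^sub>1 \<Longrightarrow> \<Delta> (Suc k) \<in> {\<gamma>\<^sub>1 * \<Delta> k..\<gamma>\<^sub>2 * \<Delta> k}"
  using run by (simp_all add: tr_run_def Let_def)

lemma Delta_pos: "0 < \<Delta> k"
proof (induction k)
  case 0
  show ?case using run by (simp add: tr_run_def)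
next
  case (Suc k)
  have "0 < \<gamma>\<^sub>3 * \<Delta> k" "0 < \<gamma>\<^sub>2 * \<Delta> k" "0 < \<gamma>\<^sub>1 * \<Delta> k"
    using gamma Suc by auto
  then show ?case
    using radius_very_successful[of k] radius_successful[of k] radius_unsuccessful[of k]
    by (cases "\<rho> k \<ge> \<eta>\<^sub>2"; cases "\<rho> k \<ge> \<eta>\<^sub>1") auto
qed

lemma Delta_Suc_ge:
  shows "\<eta>\<^sub>2 \<le> \<rho> k \<Longrightarrow> \<Delta> k \<le> \<Delta> (Suc k)" and "\<gamma>\<^sub>1 * \<Delta> k \<le> \<Delta> (Suc k)"
proof -
  have "1 * \<Delta> k \<le> \<gamma>\<^sub>3 * \<Delta> k" and *: "\<gamma>\<^sub>1 * \<Delta> k \<le> \<gamma>\<^sub>2 * \<Delta> k" "\<gamma>\<^sub>2 * \<Delta> k \<le> 1 * \<Delta> k"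
    using gamma Delta_pos[of k] by (auto intro!: mult_right_mono)
  then show very: "\<eta>\<^sub>2 \<le> \<rho> k \<Longrightarrow> \<Delta> k \<le> \<Delta> (Suc k)"
    using radius_very_successful[of k] by auto
  show "\<gamma>\<^sub>1 * \<Delta> k \<le> \<Delta> (Suc k)"
    using very * radius_successful[of k] radius_unsuccessful[of k]
    by (cases "\<rho> k \<ge> \<eta>\<^sub>2"; cases "\<rho> k \<ge> \<eta>\<^sub>1") auto
qed

lemma Delta_Suc_le:
  shows "k \<in> successful \<Longrightarrow> \<Delta> (Suc k) \<le> \<gamma>\<^sub>4 * \<Delta> k"
    and "k \<notin> successful \<Longrightarrow> \<Delta> (Suc k) \<le> \<gamma>\<^sub>2 * \<Delta> k"
proof -
  have "1 * \<Delta> k \<le> \<gamma>\<^sub>4 * \<Delta> k"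
    using gamma Delta_pos[of k] by (intro mult_right_mono) auto
  then show "k \<in> successful \<Longrightarrow> \<Delta> (Suc k) \<le> \<gamma>\<^sub>4 * \<Delta> k"
    using radius_very_successful[of k] radius_successful[of k]
    by (cases "\<rho> k \<ge> \<eta>\<^sub>2") auto
  show "k \<notin> successful \<Longrightarrow> \<Delta> (Suc k) \<le> \<gamma>\<^sub>2 * \<Delta> k"
    using radius_unsuccessful[of k] by auto
qed

section \<open>The model decrease and the optimality gap\<close>

text \<open>
  The Cauchy point is at least as good as any feasible step length \<open>u\<close> along the negative gradient, and for
  \<open>u * opnorm (B k) \<le> 1\<close> the quadratic term destroys at most half of the linear decrease. Keeping \<open>u\<close>
  free avoids the case distinction on whether the radius or the curvature limits the step, and
  it covers vanishing \<open>B k\<close>.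
\<close>

lemma cauchy_decrease:
  assumes "0 \<le> u" "u * grad_norm k \<le> radius k" "u * opnorm (B k) \<le> 1"
  shows "\<kappa> * u * (grad_norm k)\<^sup>2 \<le> model_decrease k"
proof -
  let ?m = "tr_model f g (B k) (x k)"
  let ?G2 = "(grad_norm k)\<^sup>2"
  have "?m (- (t k *\<^sub>R g (x k))) \<le> ?m (- (u *\<^sub>R g (x k)))"
    using cauchy_minimal[of k] assms by (auto simp: is_arg_min_def not_less)
  also have "\<dots> = f (x k) - u * ?G2 + 1/2 * u\<^sup>2 * (g (x k) \<bullet> (B k *v g (x k)))"
    by (simp add: tr_model_def matrix_vector_mult_scaleR dot_square_norm power2_eq_square[of u]
        linear_neg[OF matrix_vector_mul_linear])
  also have "\<dots> \<le> f (x k) - u * ?G2 + 1/2 * u\<^sup>2 * (opnorm (B k) * ?G2)"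
    by (intro add_left_mono mult_left_mono quadratic_form_le_opnorm) auto
  also have "\<dots> = f (x k) - u * ?G2 + 1/2 * (u * opnorm (B k)) * (u * ?G2)"
    by (simp add: power2_eq_square)
  also have "\<dots> \<le> f (x k) - u * ?G2 + 1/2 * 1 * (u * ?G2)"
    using assms by (intro add_left_mono mult_right_mono mult_left_mono) auto
  finally have "u * ?G2 / 2 \<le> ?m 0 - ?m (- (t k *\<^sub>R g (x k)))"
    by (simp add: tr_model_def)
  then have "2 * \<kappa> * (u * ?G2 / 2) \<le> 2 * \<kappa> * (?m 0 - ?m (- (t k *\<^sub>R g (x k))))"
    using kappa by (intro mult_left_mono) auto
  then show ?thesis
    using sufficient_decrease[of k] by simp
qed

lemma radius_nonneg: "0 \<le> radius k"
  using step_le_radius[of k] norm_ge_zero order_trans by blast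

lemma model_decrease_nonneg: "0 \<le> model_decrease k"
  using cauchy_decrease[of 0 k] radius_nonneg by simp

lemma successful_decrease:
  assumes "k \<in> successful"
  shows "\<eta>\<^sub>1 * model_decrease k \<le> f (x k) - f (x (Suc k))"
proof -
  have "model_decrease k \<noteq> 0"
    using assms eta by (auto simp: tr_ratio_def)
  then show ?thesis
    using assms model_decrease_nonneg[of k] by (simp add: iterate_Suc tr_ratio_def field_simps)
qed

lemma gap_Suc_le: "gap (Suc k) \<le> gap k"
proof (cases "k \<in> successful")
  case True
  have "0 \<le> \<eta>\<^sub>1 * model_decrease k"
    using eta model_decrease_nonneg by simp
  then show ?thesis
    using successful_decrease[OF True] by linarith
qed (simp add: iterate_Suc)

lemma gap_antimono: "i \<le> j \<Longrightarrow> gap j \<le> gap i"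
  using gap_Suc_le by (rule lift_Suc_antimono_le)

text \<open>
  The tangent at \<open>x k\<close> underestimates \<open>f\<close> at the minimizer, which is at distance at most \<open>R\<close> because the
  iterates never leave the initial level set.
\<close>

lemma gap_le_grad_norm: "gap k / R \<le> grad_norm k"
proof -
  have "gap k \<le> g (x k) \<bullet> (x k - xstar)"
    using convex_on_gradient_above_tangent[OF convex gradient, of "x k" xstar]
    by (simp add: inner_diff_right)
  also have "\<dots> \<le> grad_norm k * norm (x k - xstar)"
    by (rule norm_cauchy_schwarz)
  also have "\<dots> \<le> grad_norm k * R"
    using gap_antimono[of 0 k] by (intro mult_left_mono level_set) auto
  finally show ?thesis
    using R_ge_1 by (simp add: field_simps)
qed

lemma M_nonneg: "0 \<le> M k"
  using opnorm_nonneg opnorm_le_M order_trans by blast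

lemma psi_M_ge: "L + M k \<le> psi L \<beta> (M k)"
  using psi_ge L_ge_1 M_nonneg by blast

lemma psi_M_pos: "0 < psi L \<beta> (M k)"
  using psi_M_ge[of k] M_nonneg[of k] L_ge_1 by linarith

section \<open>Lower bound on the trust-region radius\<close>

lemma powr_div_psi_M_le:
  assumes "0 \<le> y" "y \<le> M k"
  shows "(1 + M k) powr \<beta> / psi L \<beta> (M k) \<le> (1 + y) powr \<beta> / (L + y)"
proof -
  have "(1 + M k) powr \<beta> / psi L \<beta> (M k) \<le> (1 + y) powr \<beta> / psi L \<beta> y"
    using powr_div_psi_antimono assms L_ge_1 beta by blast
  also have "\<dots> \<le> (1 + y) powr \<beta> / (L + y)"
    using psi_ge[of L y \<beta>] L_ge_1 assms by (intro divide_left_mono) auto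
  finally show ?thesis .
qed

text \<open>
  A radius below this threshold makes the model so accurate that the iteration is very successful: the step is
  then short enough for \<open>u = radius k / grad_norm k\<close> in \<open>cauchy_decrease\<close>, so the model
  decrease is linear in the radius while the model error is quadratic.
\<close>

lemma Delta_ge_of_not_very_successful:
  assumes "\<rho> k < \<eta>\<^sub>2" and G: "0 < grad_norm k"
  shows "2 * \<kappa> * (1 - \<eta>\<^sub>2) * grad_norm k powr (1 - \<alpha>)
           * ((1 + opnorm (B k)) powr \<beta> / (L + opnorm (B k))) \<le> \<Delta> k"
proof (rule ccontr)
  define b where "b = opnorm (B k)"
  define c where "c = 2 * \<kappa> * (1 - \<eta>\<^sub>2)"
  have b: "0 \<le> b" "0 < L + b"
    using opnorm_nonneg[of "B k"] L_ge_1 by (auto simp: b_def)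
  have "2 * \<kappa> * (1 - \<eta>\<^sub>2) \<le> 1 * 1"
    using kappa eta by (intro mult_mono) auto
  then have c: "0 < c" "c \<le> 1"
    using kappa eta by (auto simp: c_def)
  let ?r = "radius k" and ?G = "grad_norm k" and ?md = "model_decrease k"
  assume "\<not> ?thesis"
  then have "\<Delta> k < c * ?G powr (1 - \<alpha>) * ((1 + b) powr \<beta> / (L + b))"
    by (simp add: b_def c_def)
  moreover have r: "?r = ?G powr \<alpha> / (1 + b) powr \<beta> * \<Delta> k"
    using G by (simp add: tr_radius_def rpow_def b_def)
  moreover have "0 < ?G powr \<alpha> / (1 + b) powr \<beta>"
    using G b by simp
  ultimately have "?r < ?G powr \<alpha> / (1 + b) powr \<beta> * (c * ?G powr (1 - \<alpha>) * ((1 + b) powr \<beta> / (L + b)))"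
    by (simp only: mult_less_cancel_left_pos)
  also have "\<dots> = c * (?G powr \<alpha> * ?G powr (1 - \<alpha>)) / (L + b)"
    using b by (simp add: field_simps)
  also have "?G powr \<alpha> * ?G powr (1 - \<alpha>) = ?G"
    using G by (simp add: powr_add[symmetric])
  finally have r_less: "?r * (L + b) < c * ?G"
    using b by (simp add: field_simps)
  have r_pos: "0 < ?r"
    using r G b Delta_pos[of k] by simp
  have "?r * b \<le> ?r * (L + b)"
    using r_pos L_ge_1 by (intro mult_left_mono) auto
  also have "\<dots> \<le> 1 * ?G"
    using r_less c mult_right_mono[of c 1 ?G] by simp
  finally have "?r / ?G * b \<le> 1"
    using G by (simp add: field_simps)
  then have "\<kappa> * (?r / ?G) * ?G\<^sup>2 \<le> ?md"
    using r_pos G by (intro cauchy_decrease) (auto simp: b_def)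
  then have md: "\<kappa> * ?r * ?G \<le> ?md"
    using G by (simp add: power2_eq_square)
  then have md_pos: "0 < ?md"
    using r_pos G kappa by (smt (verit) mult_pos_pos)
  have "f (x k + s k) - tr_model f g (B k) (x k) (s k) \<le> 1/2 * (L + b) * (norm (s k))\<^sup>2"
    using model_error[of k] abs_ge_self order_trans unfolding b_def by blast
  also have "\<dots> \<le> 1/2 * (L + b) * ?r\<^sup>2"
    using b step_le_radius[of k] by (intro mult_left_mono power_mono) auto
  also have "\<dots> = 1/2 * ?r * (?r * (L + b))"
    by (simp add: power2_eq_square)
  also have "\<dots> \<le> 1/2 * ?r * (c * ?G)"
    using r_less r_pos by (intro mult_left_mono) auto
  also have "\<dots> = (1 - \<eta>\<^sub>2) * (\<kappa> * ?r * ?G)"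
    by (simp add: c_def)
  also have "\<dots> \<le> (1 - \<eta>\<^sub>2) * ?md"
    using eta md by (intro mult_left_mono) auto
  finally have error: "f (x k + s k) - tr_model f g (B k) (x k) (s k) \<le> (1 - \<eta>\<^sub>2) * ?md" .
  have "tr_model f g (B k) (x k) 0 = f (x k)"
    by (simp add: tr_model_def)
  with error have "\<eta>\<^sub>2 * ?md \<le> f (x k) - f (x k + s k)"
    by (simp add: left_diff_distrib)
  then have "\<eta>\<^sub>2 \<le> \<rho> k"
    using md_pos by (simp add: tr_ratio_def field_simps)
  with assms show False by simp
qed

lemma a_min_le_gamma1: "a_min \<le> \<gamma>\<^sub>1"
  and a_min_le: "a_min \<le> \<gamma>\<^sub>1 * (2 * \<kappa> * (1 - \<eta>\<^sub>2))"
  and a_min_le_initial: "a_min \<le> \<gamma>\<^sub>1 * (\<Delta> 0 / rpow (grad_norm 0) (1 - \<alpha>))"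
  and a_min_nonneg: "0 \<le> a_min"
proof -
  let ?q = "\<Delta> 0 / rpow (grad_norm 0) (1 - \<alpha>)"
  define c where "c = 2 * \<kappa> * (1 - \<eta>\<^sub>2)"
  have "2 * \<kappa> * (1 - \<eta>\<^sub>2) \<le> 1 * 1"
    using kappa eta by (intro mult_mono) auto
  then have c: "0 < c" "c \<le> 1"
    using kappa eta by (auto simp: c_def)
  have eq: "a_min = \<gamma>\<^sub>1 * (c * min 1 ?q)"
    by (simp add: a_min_def c_def)
  have q: "0 \<le> ?q"
    using Delta_pos[of 0] by (simp add: rpow_def)
  have "c * min 1 ?q \<le> c * 1" "c * min 1 ?q \<le> 1 * ?q"
    using c q by (intro mult_left_mono mult_mono; simp)+
  then have "c * min 1 ?q \<le> 1" "c * min 1 ?q \<le> c" "c * min 1 ?q \<le> ?q"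
    using c by auto
  note this[THEN mult_left_mono, of \<gamma>\<^sub>1]
  then show "a_min \<le> \<gamma>\<^sub>1" "a_min \<le> \<gamma>\<^sub>1 * (2 * \<kappa> * (1 - \<eta>\<^sub>2))" "a_min \<le> \<gamma>\<^sub>1 * ?q"
    using gamma(1) unfolding eq c_def[symmetric] by linarith+
  show "0 \<le> a_min"
    unfolding eq using c q gamma by auto
qed

lemma a_min_pos: "0 < grad_norm 0 \<Longrightarrow> 0 < a_min"
  using kappa eta gamma Delta_pos[of 0] rpow_pos by (auto simp: a_min_def)

text \<open>
  The radius shrinks only when it is at least the threshold of \<open>Delta_ge_of_not_very_successful\<close>, and then by a
  factor at least \<open>\<gamma>\<^sub>1\<close>, which \<open>a_min\<close> contains. The invariant survives an iteration because \<open>(1 + M k) powr \<beta> / psi L \<beta> (M k)\<close>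
  is nonincreasing in \<open>k\<close> and lies below the corresponding factor of the threshold.
\<close>

lemma Delta_lower_bound:
  assumes "0 < E" "\<And>j. j \<le> k \<Longrightarrow> E \<le> grad_norm j"
  shows "a_min * E powr (1 - \<alpha>) * ((1 + M k) powr \<beta> / psi L \<beta> (M k)) \<le> \<Delta> k"
  using assms(2)
proof (induction k)
  case 0
  have G: "0 < grad_norm 0" "E \<le> grad_norm 0"
    using assms(1) 0[of 0] by auto
  have "(1 + M 0) powr \<beta> / psi L \<beta> (M 0) \<le> 1 / L"
    using powr_div_psi_M_le[of 0 0] M_nonneg[of 0] by simp
  also have "\<dots> \<le> 1"
    using L_ge_1 by simp
  finally have "a_min * E powr (1 - \<alpha>) * ((1 + M 0) powr \<beta> / psi L \<beta> (M 0)) \<le> a_min * E powr (1 - \<alpha>) * 1"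
    using a_min_nonneg by (intro mult_left_mono) auto
  also have "\<dots> \<le> \<gamma>\<^sub>1 * (\<Delta> 0 / rpow (grad_norm 0) (1 - \<alpha>)) * grad_norm 0 powr (1 - \<alpha>)"
    unfolding mult_1_right
    using a_min_le_initial order_trans[OF a_min_nonneg a_min_le_initial] G assms(1) alpha
    by (intro mult_mono powr_mono2) auto
  also have "\<dots> \<le> \<Delta> 0"
    using G Delta_pos[of 0] gamma by (simp add: rpow_def)
  finally show ?case .
next
  case (Suc k)
  let ?phi = "\<lambda>k. (1 + M k) powr \<beta> / psi L \<beta> (M k)"
  let ?b = "opnorm (B k)"
  have phi: "?phi (Suc k) \<le> ?phi k"
    using powr_div_psi_antimono[of L \<beta> "M k" "M (Suc k)"] L_ge_1 beta M_nonneg monoD[OF mono_M, of k "Suc k"]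
    by auto
  have IH: "a_min * E powr (1 - \<alpha>) * ?phi k \<le> \<Delta> k"
    using Suc by simp
  have G: "E \<le> grad_norm k" "0 < grad_norm k"
    using Suc.prems[of k] assms(1) by auto
  have "a_min * E powr (1 - \<alpha>) * ?phi (Suc k) \<le> a_min * E powr (1 - \<alpha>) * ?phi k"
    using phi a_min_nonneg by (intro mult_left_mono) auto
  also have "\<dots> \<le> \<Delta> (Suc k)"
  proof (cases "\<eta>\<^sub>2 \<le> \<rho> k")
    case True
    then show ?thesis using IH Delta_Suc_ge(1) by fastforce
  next
    case False
    have "a_min * E powr (1 - \<alpha>) * ?phi k
        \<le> \<gamma>\<^sub>1 * (2 * \<kappa> * (1 - \<eta>\<^sub>2)) * grad_norm k powr (1 - \<alpha>) * ((1 + ?b) powr \<beta> / (L + ?b))"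
      using a_min_le a_min_nonneg G assms(1) alpha powr_div_psi_M_le[OF opnorm_nonneg opnorm_le_M, of k]
        kappa eta gamma psi_M_pos[of k]
      by (intro mult_mono powr_mono2) auto
    also have "\<dots> = \<gamma>\<^sub>1 * (2 * \<kappa> * (1 - \<eta>\<^sub>2) * grad_norm k powr (1 - \<alpha>) * ((1 + ?b) powr \<beta> / (L + ?b)))"
      by simp
    also have "\<dots> \<le> \<gamma>\<^sub>1 * \<Delta> k"
      using Delta_ge_of_not_very_successful[of k] False G gamma by (intro mult_left_mono) auto
    also have "\<dots> \<le> \<Delta> (Suc k)"
      by (rule Delta_Suc_ge)
    finally show ?thesis .
  qed
  finally show ?case .
qed

section \<open>Decrease along the successful iterations\<close>

text \<open>
  The radius carries the factor \<open>grad_norm k powr \<alpha>\<close>, which for negative \<open>\<alpha>\<close> has no lower bound in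
  terms of the gap. One more factor \<open>grad_norm k\<close> comes from the Cauchy decrease, and
  \<open>grad_norm k powr (1 + \<alpha>)\<close> is bounded below by the same power of \<open>gap k / R\<close>. The exponents
  \<open>1 + \<alpha>\<close> and \<open>1 - \<alpha>\<close>, the latter from the bound on \<open>\<Delta> k\<close>, add up to 2. The step
  length \<open>u\<close> is the one for which \<open>\<eta>\<^sub>1 * \<kappa> * u * (grad_norm k)\<^sup>2\<close> is the claimed amount.
\<close>

lemma gap_decrease_successful:
  assumes "k \<in> successful" "0 < gap k"
  shows "\<eta>\<^sub>1 * \<kappa> * a_min * (gap k / R)\<^sup>2 / psi L \<beta> (M k) \<le> gap k - gap (Suc k)"
proof -
  let ?G = "grad_norm k" and ?psi = "psi L \<beta> (M k)" and ?b = "opnorm (B k)"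
  define E where "E = gap k / R"
  have E: "0 < E" using assms R_ge_1 by (simp add: E_def)
  have E_le: "E \<le> grad_norm j" if "j \<le> k" for j
    unfolding E_def using gap_antimono[OF that] gap_le_grad_norm[of j] R_ge_1
    by (meson divide_right_mono order_trans zero_le_one)
  then have G: "E \<le> ?G" "0 < ?G" using E by fastforce+
  have b: "0 \<le> ?b" "?b \<le> M k" using opnorm_nonneg opnorm_le_M by auto
  define u where "u = a_min * E\<^sup>2 / (?psi * ?G\<^sup>2)"
  have u0: "0 \<le> u"
    using a_min_nonneg psi_M_pos[of k] by (simp add: u_def)
  have "u * ?b \<le> 1"
  proof -
    have "a_min * E\<^sup>2 * ?b \<le> 1 * ?G\<^sup>2 * ?psi"
      using a_min_le_gamma1 gamma a_min_nonneg E G b psi_M_ge[of k] L_ge_1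
      by (intro mult_mono power_mono) auto
    moreover have "0 < ?psi * ?G\<^sup>2"
      using G psi_M_pos[of k] by simp
    ultimately show ?thesis
      by (simp add: u_def mult.commute)
  qed
  moreover have "u * ?G \<le> radius k"
  proof -
    have "E\<^sup>2 = E powr (1 + \<alpha>) * E powr (1 - \<alpha>)"
      using E by (simp add: powr_add[symmetric])
    then have "a_min * E\<^sup>2 / ?psi = E powr (1 + \<alpha>) * (a_min * E powr (1 - \<alpha>) / ?psi)"
      by simp
    also have "\<dots> \<le> ?G powr (1 + \<alpha>) * (a_min * E powr (1 - \<alpha>) / ?psi)"
      using E G alpha a_min_nonneg psi_M_pos[of k] by (intro mult_right_mono powr_mono2) auto
    also have "\<dots> \<le> ?G powr (1 + \<alpha>) * (\<Delta> k / (1 + ?b) powr \<beta>)"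
    proof (rule mult_left_mono)
      have "a_min * E powr (1 - \<alpha>) / ?psi
          = a_min * E powr (1 - \<alpha>) * ((1 + M k) powr \<beta> / ?psi) / (1 + M k) powr \<beta>"
        using M_nonneg[of k] by simp
      also have "\<dots> \<le> \<Delta> k / (1 + M k) powr \<beta>"
        using Delta_lower_bound[OF E E_le] by (intro divide_right_mono) auto
      also have "\<dots> \<le> \<Delta> k / (1 + ?b) powr \<beta>"
        using Delta_pos[of k] b beta by (intro divide_left_mono powr_mono2) auto
      finally show "a_min * E powr (1 - \<alpha>) / ?psi \<le> \<Delta> k / (1 + ?b) powr \<beta>" .
    qed simp
    also have "\<dots> = radius k * ?G"
      using G by (simp add: tr_radius_def rpow_def powr_add)
    finally have "a_min * E\<^sup>2 / ?psi / ?G \<le> radius k"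
      using G by (simp only: pos_divide_le_eq)
    moreover have "u * ?G = a_min * E\<^sup>2 / ?psi / ?G"
      by (simp add: u_def power2_eq_square)
    ultimately show ?thesis by simp
  qed
  ultimately have "\<kappa> * u * ?G\<^sup>2 \<le> model_decrease k"
    using u0 by (intro cauchy_decrease)
  then have "\<eta>\<^sub>1 * (\<kappa> * u * ?G\<^sup>2) \<le> \<eta>\<^sub>1 * model_decrease k"
    using eta by (intro mult_left_mono) auto
  also have "\<dots> \<le> gap k - gap (Suc k)"
    using successful_decrease[OF assms(1)] by simp
  also have "\<eta>\<^sub>1 * (\<kappa> * u * ?G\<^sup>2) = \<eta>\<^sub>1 * \<kappa> * a_min * (gap k / R)\<^sup>2 / ?psi"
    using G by (simp add: u_def E_def)
  finally show ?thesis .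
qed

text \<open>
  A decrease proportional to the square of the gap is an increase of its reciprocal by at least the same factor.
  The term \<open>1 / gap 0\<close> is kept: it is the slack that later absorbs the shift from \<open>log \<gamma>\<^sub>2 (\<epsilon> / R)\<close> to
  \<open>log \<gamma>\<^sub>2 \<epsilon>\<close>.
\<close>

lemma sum_successful_le:
  assumes "0 < gap k"
  shows "\<eta>\<^sub>1 * \<kappa> * a_min / R\<^sup>2 * (\<Sum>j \<in> successful \<inter> {..<k}. 1 / psi L \<beta> (M j)) \<le> 1 / gap k - 1 / gap 0"
  using assms
proof (induction k)
  case (Suc k)
  let ?c = "\<eta>\<^sub>1 * \<kappa> * a_min / R\<^sup>2"
  have pos: "0 < gap k" using Suc.prems gap_Suc_le[of k] by linarith
  have "1 / gap k \<le> 1 / gap (Suc k)"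
    using Suc.prems gap_Suc_le[of k] by (intro divide_left_mono) auto
  have IH: "?c * (\<Sum>j \<in> successful \<inter> {..<k}. 1 / psi L \<beta> (M j)) \<le> 1 / gap k - 1 / gap 0"
    by (rule Suc.IH[OF pos])
  show ?case
  proof (cases "k \<in> successful")
    case True
    have "?c * (1 / psi L \<beta> (M k)) = (\<eta>\<^sub>1 * \<kappa> * a_min * (gap k / R)\<^sup>2 / psi L \<beta> (M k)) / (gap k)\<^sup>2"
      using pos by (simp add: power_divide)
    also have "\<dots> \<le> (gap k - gap (Suc k)) / (gap k)\<^sup>2"
      by (intro divide_right_mono gap_decrease_successful True pos) simp
    also have "\<dots> \<le> (gap k - gap (Suc k)) / (gap k * gap (Suc k))"
      unfolding power2_eq_square
      using pos Suc.prems gap_Suc_le[of k] by (intro divide_left_mono mult_left_mono mult_pos_pos) linarith+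
    also have "\<dots> = 1 / gap (Suc k) - 1 / gap k"
      using pos Suc.prems by (metis diff_frac_eq mult.commute mult_1 order_less_irrefl)
    finally have "?c * (1 / psi L \<beta> (M k)) \<le> 1 / gap (Suc k) - 1 / gap k" .
    moreover have "(\<Sum>j \<in> successful \<inter> {..<Suc k}. 1 / psi L \<beta> (M j))
        = 1 / psi L \<beta> (M k) + (\<Sum>j \<in> successful \<inter> {..<k}. 1 / psi L \<beta> (M j))"
      using True by (simp add: lessThan_Suc Int_insert_right del: mem_Collect_eq)
    ultimately show ?thesis
      using IH by (simp only: distrib_left)
  next
    case False
    then have "successful \<inter> {..<Suc k} = successful \<inter> {..<k}"
      by (auto simp: less_Suc_eq)
    then show ?thesis
      using IH \<open>1 / gap k \<le> 1 / gap (Suc k)\<close> by simp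
  qed
qed simp

section \<open>From successful iterations to all iterations\<close>

lemma Delta_upper_bound:
  shows "\<Delta> k \<le> \<Delta> 0 * \<gamma>\<^sub>4 ^ card (successful \<inter> {..<k}) * \<gamma>\<^sub>2 ^ (k - card (successful \<inter> {..<k}))"
proof (induction k)
  case (Suc k)
  let ?S = "card (successful \<inter> {..<k})"
  have le: "?S \<le> k"
    using card_mono[of "{..<k}" "successful \<inter> {..<k}"] by simp
  show ?case
  proof (cases "k \<in> successful")
    case True
    then have "card (successful \<inter> {..<Suc k}) = Suc ?S"
      by (simp add: lessThan_Suc Int_insert_right del: mem_Collect_eq)
    moreover have "\<Delta> (Suc k) \<le> \<gamma>\<^sub>4 * (\<Delta> 0 * \<gamma>\<^sub>4 ^ ?S * \<gamma>\<^sub>2 ^ (k - ?S))"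
      using Delta_Suc_le(1)[OF True] mult_left_mono[OF Suc, of \<gamma>\<^sub>4] gamma by linarith
    ultimately show ?thesis by (simp add: algebra_simps)
  next
    case False
    then have "successful \<inter> {..<Suc k} = successful \<inter> {..<k}"
      by (auto simp: less_Suc_eq)
    moreover have "\<Delta> (Suc k) \<le> \<gamma>\<^sub>2 * (\<Delta> 0 * \<gamma>\<^sub>4 ^ ?S * \<gamma>\<^sub>2 ^ (k - ?S))"
      using Delta_Suc_le(2)[OF False] mult_left_mono[OF Suc, of \<gamma>\<^sub>2] gamma by linarith
    ultimately show ?thesis using le by (simp add: Suc_diff_le algebra_simps)
  qed
qed simp

text \<open>
  An iteration \<open>n + i\<close> is either preceded by more than \<open>i / \<tau>\<close> successful ones, and such iterations are charged
  to the successful ones with multiplicity \<open>\<tau>\<close>, or successes are so rare that the radius has decayed like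
  \<open>\<theta> powr (i / \<tau>)\<close>. In the second case the lower bound on the radius forces the weight
  \<open>1 / psi L \<beta> (M (n + i))\<close> itself below that geometric term. Starting at \<open>n\<close> with
  \<open>\<Delta> 0 * \<gamma>\<^sub>2 ^ n \<le> a_min * E powr (1 - \<alpha>)\<close> makes the constant in front of the geometric term equal to 1.
\<close>

lemma sum_tail_le:
  fixes \<tau> n K :: nat
  defines "\<theta> \<equiv> \<gamma>\<^sub>4 * \<gamma>\<^sub>2 ^ (\<tau> - 1)"
  assumes \<tau>: "0 < \<tau>" "\<theta> < 1"
    and E: "0 < E" "\<And>j. j \<le> K \<Longrightarrow> E \<le> grad_norm j"
    and n: "\<Delta> 0 * \<gamma>\<^sub>2 ^ n \<le> a_min * E powr (1 - \<alpha>)" "n \<le> K"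
  shows "(\<Sum>k=n..<Suc K. 1 / psi L \<beta> (M k))
    \<le> real \<tau> * (\<Sum>j \<in> successful \<inter> {..<K}. 1 / psi L \<beta> (M j))
       + (\<Sum>k. \<theta> powr (real k / real \<tau>))"
proof -
  let ?a = "\<lambda>k. 1 / psi L \<beta> (M k)" and ?S = "\<lambda>k. card (successful \<inter> {..<k})"
  let ?geo = "\<lambda>i::nat. \<theta> powr (real i / real \<tau>)"
  have "0 < \<theta>"
    using gamma by (auto simp: \<theta>_def intro!: mult_pos_pos)
  have "0 < a_min"
    using E(1) E(2)[of 0] by (intro a_min_pos) linarith
  define I where "I = {i. i \<le> K - n \<and> i < \<tau> * ?S (n + i)}"
  have fin: "finite I" by (simp add: I_def)
  have sparse: "?a (n + i) \<le> ?geo i" if i: "i \<le> K - n" "\<tau> * ?S (n + i) \<le> i" for i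
  proof -
    let ?s = "?S (n + i)"
    have "1 * ?s \<le> \<tau> * ?s"
      using \<tau> by (intro mult_le_mono1) auto
    then have "?s \<le> i" using i by linarith
    have "a_min * E powr (1 - \<alpha>) * ((1 + M (n + i)) powr \<beta> * ?a (n + i)) \<le> \<Delta> (n + i)"
      using Delta_lower_bound[of E "n + i"] E i n by simp
    also have "\<dots> \<le> \<Delta> 0 * \<gamma>\<^sub>4 ^ ?s * \<gamma>\<^sub>2 ^ (n + i - ?s)"
      by (rule Delta_upper_bound)
    also have "\<dots> = \<Delta> 0 * \<gamma>\<^sub>2 ^ n * (\<gamma>\<^sub>4 ^ ?s * \<gamma>\<^sub>2 ^ (i - ?s))"
      using \<open>?s \<le> i\<close> by (simp add: power_add[symmetric] algebra_simps)
    also have "\<dots> \<le> a_min * E powr (1 - \<alpha>) * ?geo i"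
      unfolding \<theta>_def using gamma \<tau> i a_min_nonneg
      by (intro mult_mono n power_mult_power_le_powr) auto
    finally have "(1 + M (n + i)) powr \<beta> * ?a (n + i) \<le> ?geo i"
      by (rule mult_left_le_imp_le) (use \<open>0 < a_min\<close> E(1) in simp)
    moreover have "1 \<le> (1 + M (n + i)) powr \<beta>"
      using M_nonneg beta by (intro ge_one_powr_ge_zero) auto
    then have "1 * ?a (n + i) \<le> (1 + M (n + i)) powr \<beta> * ?a (n + i)"
      using psi_M_pos[of "n + i"] by (intro mult_right_mono) auto
    ultimately show ?thesis by linarith
  qed
  have "(\<Sum>k=n..<Suc K. ?a k) = (\<Sum>i<Suc (K - n). ?a (n + i))"
    using sum.shift_bounds_nat_ivl[of ?a 0 n "Suc (K - n)"] n
    by (simp add: add.commute lessThan_atLeast0 Suc_diff_le del: sum.op_ivl_Suc)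
  also have "\<dots> = (\<Sum>i\<in>I. ?a (n + i)) + (\<Sum>i\<in>{..<Suc (K - n)} - I. ?a (n + i))"
    by (subst add.commute, intro sum.subset_diff) (auto simp: I_def)
  also have "(\<Sum>i\<in>I. ?a (n + i)) \<le> real \<tau> * (\<Sum>j \<in> successful \<inter> {..<n + (K - n)}. ?a j)"
  proof (rule sum_le_sum_on_dense_set[OF _ _ \<tau>(1)])
    show "antimono ?a"
      using psi_M_pos mono_M L_ge_1
      by (intro antimonoI divide_left_mono psi_mono monoD[OF mono_M] mult_pos_pos) auto
    show "0 \<le> ?a k" for k using psi_M_pos[of k] by simp
  qed (auto simp: I_def)
  also have "(\<Sum>i\<in>{..<Suc (K - n)} - I. ?a (n + i)) \<le> (\<Sum>i\<in>{..<Suc (K - n)} - I. ?geo i)"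
    by (intro sum_mono sparse) (auto simp: I_def)
  also have "\<dots> \<le> (\<Sum>i. ?geo i)"
    using \<tau> \<open>0 < \<theta>\<close> by (intro sum_le_suminf summable_powr_divide) auto
  finally show ?thesis using n by simp
qed

lemma sum_powr_le:
  fixes \<tau> n K :: nat
  assumes \<tau>: "0 < \<tau>" "\<gamma>\<^sub>4 * \<gamma>\<^sub>2 ^ (\<tau> - 1) < 1"
    and \<epsilon>: "0 < \<epsilon>" "\<epsilon> < gap K"
    and growth: "\<And>k. 1 \<le> k \<Longrightarrow> psi L \<beta> (M k) \<le> \<Psi> * real k powr p" and "0 < \<Psi>"
    and n: "\<Delta> 0 * \<gamma>\<^sub>2 ^ n \<le> a_min * (\<epsilon> / R) powr (1 - \<alpha>)" "1 \<le> n" "n \<le> K"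
  shows "(\<Sum>k=n..<Suc K. real k powr - p)
    \<le> real \<tau> * R\<^sup>2 * (\<Psi> / (\<eta>\<^sub>1 * \<kappa> * a_min)) * (1 / \<epsilon> - 1 / gap 0)
       + \<Psi> * (\<Sum>k. (\<gamma>\<^sub>4 * \<gamma>\<^sub>2 ^ (\<tau> - 1)) powr (real k / real \<tau>))"
proof -
  let ?xi = "\<Sum>k. (\<gamma>\<^sub>4 * \<gamma>\<^sub>2 ^ (\<tau> - 1)) powr (real k / real \<tau>)"
  let ?succ = "\<Sum>j \<in> successful \<inter> {..<K}. 1 / psi L \<beta> (M j)"
  have E: "0 < \<epsilon> / R" "\<epsilon> / R \<le> grad_norm j" if "j \<le> K" for j
  proof -
    have "\<epsilon> / R \<le> gap j / R"
      using gap_antimono[OF that] \<epsilon> R_ge_1 by (intro divide_right_mono) auto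
    then show "\<epsilon> / R \<le> grad_norm j"
      using gap_le_grad_norm order_trans by blast
  qed (use \<epsilon> R_ge_1 in simp)
  have amin: "0 < a_min"
    using E[of 0] by (intro a_min_pos) linarith
  have "\<eta>\<^sub>1 * \<kappa> * a_min / R\<^sup>2 * ?succ \<le> 1 / gap K - 1 / gap 0"
    using \<epsilon> by (intro sum_successful_le) simp
  also have "\<dots> \<le> 1 / \<epsilon> - 1 / gap 0"
    using \<epsilon> by (intro diff_right_mono divide_left_mono) auto
  finally have succ: "?succ \<le> R\<^sup>2 / (\<eta>\<^sub>1 * \<kappa> * a_min) * (1 / \<epsilon> - 1 / gap 0)"
    using amin eta kappa R_ge_1 by (simp add: field_simps)
  have "(\<Sum>k=n..<Suc K. real k powr - p) \<le> (\<Sum>k=n..<Suc K. \<Psi> * (1 / psi L \<beta> (M k)))"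
  proof (rule sum_mono)
    fix k assume "k \<in> {n..<Suc K}"
    then have "1 \<le> k" using n by simp
    then show "real k powr - p \<le> \<Psi> * (1 / psi L \<beta> (M k))"
      using growth[of k] psi_M_pos[of k] by (simp add: powr_minus field_simps)
  qed
  also have "\<dots> = \<Psi> * (\<Sum>k=n..<Suc K. 1 / psi L \<beta> (M k))"
    by (simp add: sum_distrib_left del: sum.op_ivl_Suc)
  also have "\<dots> \<le> \<Psi> * (real \<tau> * ?succ + ?xi)"
    using \<open>0 < \<Psi>\<close> \<tau> E n by (intro mult_left_mono sum_tail_le[of \<tau> "\<epsilon> / R"]) auto
  also have "\<dots> \<le> \<Psi> * (real \<tau> * (R\<^sup>2 / (\<eta>\<^sub>1 * \<kappa> * a_min) * (1 / \<epsilon> - 1 / gap 0)) + ?xi)"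
    using \<open>0 < \<Psi>\<close> succ by (intro mult_left_mono add_right_mono) auto
  finally show ?thesis
    by (simp add: distrib_left mult.assoc mult.left_commute)
qed

text \<open>
  The bound \<open>1 \<le> n\<close>, needed since the terms \<open>k powr - p\<close> are summed from \<open>n\<close> on, comes from
  \<open>a_min * (\<epsilon> / R) powr (1 - \<alpha>) \<le> \<gamma>\<^sub>1 * \<Delta> 0 < \<Delta> 0\<close>: the solution \<open>T\<close> of
  \<open>\<Delta> 0 * \<gamma>\<^sub>2 powr T = a_min * (\<epsilon> / R) powr (1 - \<alpha>)\<close> is positive, and \<open>n\<close> is \<open>T\<close> rounded up.
\<close>

lemma obtain_tail_start:
  assumes \<epsilon>: "0 < \<epsilon>" "\<epsilon> < gap 0"
  obtains n where "\<Delta> 0 * \<gamma>\<^sub>2 ^ n \<le> a_min * (\<epsilon> / R) powr (1 - \<alpha>)" "1 \<le> n"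
    "real n \<le> (1 - \<alpha>) * log \<gamma>\<^sub>2 (\<epsilon> / R) + log \<gamma>\<^sub>2 (a_min / \<Delta> 0) + 1"
proof -
  define T where "T = (1 - \<alpha>) * log \<gamma>\<^sub>2 (\<epsilon> / R) + log \<gamma>\<^sub>2 (a_min / \<Delta> 0)"
  have "\<epsilon> / R \<le> gap 0 / R"
    using \<epsilon> R_ge_1 by (intro divide_right_mono) auto
  then have E: "0 < \<epsilon> / R" "\<epsilon> / R \<le> grad_norm 0"
    using \<epsilon> R_ge_1 gap_le_grad_norm[of 0] by auto
  have amin: "0 < a_min"
    using E by (intro a_min_pos) linarith
  have T: "\<gamma>\<^sub>2 powr T = a_min / \<Delta> 0 * (\<epsilon> / R) powr (1 - \<alpha>)"
  proof -
    have "log \<gamma>\<^sub>2 (a_min / \<Delta> 0 * (\<epsilon> / R) powr (1 - \<alpha>)) = T"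
      using E(1) amin Delta_pos[of 0] \<epsilon>(1) R_ge_1 unfolding T_def
      by (subst log_mult_pos) (simp_all add: log_powr)
    then show ?thesis
      using E(1) amin Delta_pos[of 0] gamma by (metis powr_log_cancel divide_pos_pos mult_pos_pos
          powr_gt_zero less_irrefl order_less_le_trans)
  qed
  have "a_min * (\<epsilon> / R) powr (1 - \<alpha>)
      \<le> \<gamma>\<^sub>1 * (\<Delta> 0 / rpow (grad_norm 0) (1 - \<alpha>)) * grad_norm 0 powr (1 - \<alpha>)"
    using a_min_le_initial order_trans[OF a_min_nonneg a_min_le_initial] E alpha
    by (intro mult_mono powr_mono2) auto
  also have "\<dots> = \<gamma>\<^sub>1 * \<Delta> 0"
    using E by (auto simp: rpow_def)
  finally have "\<gamma>\<^sub>2 powr T \<le> \<gamma>\<^sub>1"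
    using Delta_pos[of 0] by (simp add: T field_simps)
  then have "\<gamma>\<^sub>2 powr T < 1"
    using gamma by linarith
  then have "0 < T"
    using gamma powr_mono'[of T 0 \<gamma>\<^sub>2] by (cases "0 < T") auto
  define n where "n = nat \<lceil>T\<rceil>"
  have n: "T \<le> real n" "real n \<le> T + 1" "1 \<le> n"
    using \<open>0 < T\<close> unfolding n_def by linarith+
  have "\<gamma>\<^sub>2 ^ n = \<gamma>\<^sub>2 powr real n"
    using gamma by (simp add: powr_realpow)
  also have "\<dots> \<le> \<gamma>\<^sub>2 powr T"
    using gamma n by (intro powr_mono') auto
  finally have "\<Delta> 0 * \<gamma>\<^sub>2 ^ n \<le> a_min * (\<epsilon> / R) powr (1 - \<alpha>)"
    using Delta_pos[of 0] by (simp add: T field_simps)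
  with n show ?thesis
    using that by (simp add: T_def)
qed

section \<open>Bounds on the iteration count for a fixed accuracy\<close>

text \<open>
  \<open>k\<^sub>0\<close> bounds the end of the initial phase, and \<open>X\<close> bounds the sum of \<open>k powr - p\<close> from there to \<open>K\<close>.
\<close>

context
  fixes \<tau> K :: nat and \<epsilon> \<Psi> p X k\<^sub>0 :: real
  assumes \<tau>: "0 < \<tau>" "\<gamma>\<^sub>4 * \<gamma>\<^sub>2 ^ (\<tau> - 1) < 1"
    and \<epsilon>: "0 < \<epsilon>" "\<epsilon> < gap K"
    and growth: "\<And>k. 1 \<le> k \<Longrightarrow> psi L \<beta> (M k) \<le> \<Psi> * real k powr p" and \<Psi>: "0 < \<Psi>"
  defines "X \<equiv> real \<tau> * R\<^sup>2 * (\<Psi> / (\<eta>\<^sub>1 * \<kappa> * a_min)) * (1 / \<epsilon> - 1 / gap 0)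
       + \<Psi> * (\<Sum>k. (\<gamma>\<^sub>4 * \<gamma>\<^sub>2 ^ (\<tau> - 1)) powr (real k / real \<tau>))"
    and "k\<^sub>0 \<equiv> (1 - \<alpha>) * log \<gamma>\<^sub>2 (\<epsilon> / R) + log \<gamma>\<^sub>2 (a_min / \<Delta> 0) + 1"
begin

lemma sum_powr_le_X:
  obtains n where "1 \<le> n" "real n \<le> k\<^sub>0" "n \<le> K \<Longrightarrow> (\<Sum>k=n..<Suc K. real k powr - p) \<le> X"
proof -
  have "\<epsilon> < gap 0"
    using \<epsilon> gap_antimono[of 0 K] by simp
  then show ?thesis
    using obtain_tail_start[of \<epsilon>] \<epsilon>(1) sum_powr_le[OF \<tau> \<epsilon> growth \<Psi>] that
    unfolding X_def k\<^sub>0_def by metis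
qed

lemma X_nonneg: "0 \<le> X"
proof -
  have "1 / gap 0 \<le> 1 / \<epsilon>"
    using \<epsilon> gap_antimono[of 0 K] by (intro divide_left_mono) auto
  moreover have "0 \<le> (\<Sum>k. (\<gamma>\<^sub>4 * \<gamma>\<^sub>2 ^ (\<tau> - 1)) powr (real k / real \<tau>))"
    using \<tau> gamma by (intro suminf_nonneg summable_powr_divide mult_pos_pos) auto
  ultimately show ?thesis
    using \<Psi> a_min_nonneg eta kappa unfolding X_def
    by (intro add_nonneg_nonneg mult_nonneg_nonneg divide_nonneg_nonneg) auto
qed

lemma iteration_bound_of_p_less_1:
  assumes "0 \<le> p" "p < 1"
  shows "real K powr (1 - p) \<le> (1 - p) * X + k\<^sub>0 powr (1 - p)"
proof -
  obtain n where n: "1 \<le> n" "real n \<le> k\<^sub>0"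
    "n \<le> K \<Longrightarrow> (\<Sum>k=n..<Suc K. real k powr - p) \<le> X"
    using sum_powr_le_X by metis
  show ?thesis
  proof (cases "n \<le> K")
    case True
    have "real K powr (1 - p) \<le> real (Suc K) powr (1 - p)"
      using assms by (intro powr_mono2) auto
    also have "\<dots> \<le> (1 - p) * (\<Sum>k=n..<Suc K. real k powr - p) + real n powr (1 - p)"
      using sum_powr_ge_powr_diff[of p n "Suc K"] assms n True by linarith
    also have "\<dots> \<le> (1 - p) * X + k\<^sub>0 powr (1 - p)"
      using assms n True by (intro add_mono mult_left_mono powr_mono2) auto
    finally show ?thesis .
  next
    case False
    have "real K powr (1 - p) \<le> k\<^sub>0 powr (1 - p)"
      using assms n False by (intro powr_mono2) auto
    moreover have "0 \<le> (1 - p) * X"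
      using assms X_nonneg by simp
    ultimately show ?thesis by linarith
  qed
qed

lemma iteration_bound_of_p_eq_1:
  assumes "p = 1"
  shows "real K \<le> k\<^sub>0 * exp X"
proof -
  obtain n where n: "1 \<le> n" "real n \<le> k\<^sub>0"
    "n \<le> K \<Longrightarrow> (\<Sum>k=n..<Suc K. real k powr - p) \<le> X"
    using sum_powr_le_X by metis
  show ?thesis
  proof (cases "n \<le> K")
    case True
    have "(\<Sum>k=n..<Suc K. 1 / real k) = (\<Sum>k=n..<Suc K. real k powr - p)"
      using n assms by (intro sum.cong) (auto simp: powr_minus field_simps)
    then have "ln (real (Suc K)) - ln (real n) \<le> X"
      using sum_inverse_ge_ln_diff[of n "Suc K"] n True by linarith
    then have "exp (ln (real (Suc K))) \<le> exp (ln (real n) + X)"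
      by (simp only: exp_le_cancel_iff)
    then have "real (Suc K) \<le> real n * exp X"
      using n by (simp add: exp_add)
    also have "\<dots> \<le> k\<^sub>0 * exp X"
      using n by (intro mult_right_mono) auto
    finally show ?thesis by simp
  next
    case False
    have "real K \<le> k\<^sub>0 * 1"
      using n False by simp
    also have "\<dots> \<le> k\<^sub>0 * exp X"
      using n X_nonneg by (intro mult_left_mono) auto
    finally show ?thesis .
  qed
qed

end

end

section \<open>Small accuracies\<close>

lemma filterlim_log_at_right_0:
  fixes b :: real
  assumes "0 < b" "b < 1"
  shows "filterlim (log b) at_top (at_right 0)"
proof -
  have "filterlim (\<lambda>x. (1 / ln b) * ln x) at_top (at_right 0)"
    using assms ln_at_0
    by (subst filterlim_tendsto_neg_mult_at_top_iff[OF tendsto_const]) auto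
  then show ?thesis
    by (simp add: log_def[abs_def])
qed

lemma filterlim_affine_log_at_right_0:
  fixes a b k :: real
  assumes "0 < b" "b < 1" "0 < a"
  shows "filterlim (\<lambda>x. a * log b x + k) at_top (at_right 0)"
proof -
  have "filterlim (\<lambda>x. k + a * log b x) at_top (at_right 0)"
    using assms
    by (intro filterlim_tendsto_add_at_top[OF tendsto_const] filterlim_log_at_right_0
        filterlim_tendsto_pos_mult_at_top[OF tendsto_const])
  then show ?thesis by (simp add: add.commute)
qed

text \<open>
  By concavity a shift by \<open>D\<close> changes \<open>y powr q\<close> by at most \<open>q * D * y powr (q - 1)\<close>, which vanishes
  as \<open>y\<close> grows since \<open>q < 1\<close>.
\<close>

lemma eventually_powr_add_const_le:
  fixes y :: "'a \<Rightarrow> real"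
  assumes "filterlim y at_top F" "0 \<le> D" "0 < c" "0 \<le> q" "q < 1"
  shows "eventually (\<lambda>e. (y e + D) powr q \<le> y e powr q + c) F"
proof -
  have "((\<lambda>e. q * D * y e powr (q - 1)) \<longlongrightarrow> q * D * 0) F"
    using assms by (intro tendsto_intros tendsto_neg_powr) auto
  then have "eventually (\<lambda>e. q * D * y e powr (q - 1) < c) F"
    using assms by (intro order_tendstoD) auto
  moreover have "eventually (\<lambda>e. 0 < y e) F"
    using assms by (simp add: filterlim_at_top_dense)
  ultimately show ?thesis
  proof eventually_elim
    case (elim e)
    then show ?case
      using powr_increment_le[of "y e" D q] assms by auto
  qed
qed

lemma eventually_add_const_le_mult_exp:
  fixes y :: "'a \<Rightarrow> real"
  assumes "filterlim y at_top F" "0 < c"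
  shows "eventually (\<lambda>e. y e + D \<le> y e * exp c) F"
proof -
  have "eventually (\<lambda>e. max 0 (D / c) \<le> y e) F"
    using assms(1) unfolding filterlim_at_top by blast
  then show ?thesis
  proof eventually_elim
    case (elim e)
    then have "y e + D \<le> y e * (1 + c)"
      using assms by (simp add: field_simps)
    also have "\<dots> \<le> y e * exp c"
      using elim by (intro mult_left_mono exp_ge_add_one_self) auto
    finally show ?case .
  qed
qed

text \<open>
  The base of the power is \<open>O(q / \<epsilon>)\<close>, because a logarithm is dominated by \<open>1 / \<epsilon>\<close> and its power with
  exponent \<open>q < 1\<close> is at most an affine function of it.
\<close>

lemma iteration_bound_bigo:
  fixes a b q :: real
  assumes "0 < b" "b < 1" "0 \<le> a" "0 < q" "q < 1" "0 \<le> C" "0 \<le> d"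
  shows "(\<lambda>\<epsilon>. (q * (C / \<epsilon> + d) + (a * log b \<epsilon> + k) powr q) powr (1 / q))
           \<in> O[at_right 0](\<lambda>\<epsilon>. (q / \<epsilon>) powr (1 / q))"
proof (rule bigo_powr_nonneg)
  let ?y = "\<lambda>\<epsilon>. a * log b \<epsilon> + k"
  have pos: "eventually (\<lambda>\<epsilon>::real. 0 < \<epsilon> \<and> \<epsilon> < 1) (at_right 0)"
    by (auto simp: eventually_at_right_field intro: exI[of _ 1])
  have const: "(\<lambda>_. c) \<in> O[at_right 0](\<lambda>\<epsilon>. q / \<epsilon>)" for c :: real
  proof (rule bigoI)
    show "eventually (\<lambda>\<epsilon>. norm c \<le> \<bar>c\<bar> / q * norm (q / \<epsilon>)) (at_right 0)"
      using pos by eventually_elim (use assms in \<open>auto simp: field_simps mult_left_le_one_le\<close>)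
  qed
  have "ln \<in> O[at_right 0](\<lambda>\<epsilon>. q / \<epsilon>)"
  proof (rule bigoI)
    show "eventually (\<lambda>\<epsilon>. norm (ln \<epsilon>) \<le> 1 / q * norm (q / \<epsilon>)) (at_right 0)"
      using pos
    proof eventually_elim
      case (elim \<epsilon>)
      then show ?case
        using ln_le_minus_one[of "1 / \<epsilon>"] assms by (simp add: ln_div)
    qed
  qed
  then have "(\<lambda>\<epsilon>. (a / ln b) * ln \<epsilon> + k) \<in> O[at_right 0](\<lambda>\<epsilon>. q / \<epsilon>)"
    by (intro sum_in_bigo const) (cases "a / ln b = 0"; auto)
  then have y: "?y \<in> O[at_right 0](\<lambda>\<epsilon>. q / \<epsilon>)"
    by (simp add: log_def)
  have "(\<lambda>\<epsilon>. ?y \<epsilon> powr q) \<in> O[at_right 0](\<lambda>\<epsilon>. q / \<epsilon>)"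
  proof (cases "a = 0")
    case True
    then show ?thesis using const by simp
  next
    case False
    have "filterlim ?y at_top (at_right 0)"
      using False assms by (intro filterlim_affine_log_at_right_0) auto
    then have "eventually (\<lambda>\<epsilon>. 0 < ?y \<epsilon>) (at_right 0)"
      by (simp add: filterlim_at_top_dense)
    then have "(\<lambda>\<epsilon>. ?y \<epsilon> powr q) \<in> O[at_right 0](\<lambda>\<epsilon>. 1 + q * (?y \<epsilon> - 1))"
      by (intro landau_o.big_mono, eventually_elim)
        (use powr_le_affine assms in \<open>fastforce intro: order_trans[OF _ abs_ge_self]\<close>)
    also have "(\<lambda>\<epsilon>. 1 + q * (?y \<epsilon> - 1)) \<in> O[at_right 0](\<lambda>\<epsilon>. q / \<epsilon>)"
      using assms landau_o.big.cmult_in_iff[of q] sum_in_bigo(2)[OF y const]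
      by (intro sum_in_bigo const) simp_all
    finally show ?thesis .
  qed
  moreover have "(\<lambda>\<epsilon>. q * (C / \<epsilon> + d)) \<in> O[at_right 0](\<lambda>\<epsilon>. q / \<epsilon>)"
  proof -
    have "(\<lambda>\<epsilon>. C * (q / \<epsilon>)) \<in> O[at_right 0](\<lambda>\<epsilon>. q / \<epsilon>)"
      by (rule bigoI[of _ "\<bar>C\<bar>"]) (simp add: abs_mult)
    then have "(\<lambda>\<epsilon>. C * (q / \<epsilon>) + q * d) \<in> O[at_right 0](\<lambda>\<epsilon>. q / \<epsilon>)"
      by (intro sum_in_bigo const)
    then show ?thesis
      by (simp add: distrib_left mult.commute)
  qed
  ultimately show "(\<lambda>\<epsilon>. q * (C / \<epsilon> + d) + ?y \<epsilon> powr q) \<in> O[at_right 0](\<lambda>\<epsilon>. q / \<epsilon>)"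
    by (rule sum_in_bigo(1)[rotated])
  show "eventually (\<lambda>\<epsilon>. 0 \<le> q * (C / \<epsilon> + d) + ?y \<epsilon> powr q) (at_right 0)"
    using pos by eventually_elim (use assms in auto)
  show "eventually (\<lambda>\<epsilon>. 0 \<le> q / \<epsilon>) (at_right 0)"
    using pos by eventually_elim (use assms in auto)
qed (use assms in auto)

section \<open>The worst-case bound\<close>

theorem theorem11:
  fixes f :: "real^'n \<Rightarrow> real" and g :: "real^'n \<Rightarrow> real^'n"
    and xstar :: "real^'n" and x s :: "nat \<Rightarrow> real^'n"
    and \<Delta> t :: "nat \<Rightarrow> real" and B :: "nat \<Rightarrow> real^'n^'n"
    and \<eta>\<^sub>1 \<eta>\<^sub>2 \<gamma>\<^sub>1 \<gamma>\<^sub>2 \<gamma>\<^sub>3 \<gamma>\<^sub>4 \<kappa>mdc \<alpha> \<beta> :: real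
    and flow R L \<mu> p \<xi> amin \<kappa>\<^sub>0 \<kappa>\<^sub>3 \<kappa>\<^sub>4 :: real and \<tau> :: nat and \<delta> :: "nat \<Rightarrow> real"
  assumes gradient: "\<And>y. GDERIV f y :> g y" and gradient_cont: "continuous_on UNIV g"
    and convex: "convex_on UNIV f"
    and minimizer: "\<And>y. f xstar \<le> f y" and flow: "flow = f xstar"
    and R: "R \<ge> 1" "\<And>y. f y \<le> f (x 0) \<Longrightarrow> norm (y - xstar) \<le> R"
    and params: "tr_params \<eta>\<^sub>1 \<eta>\<^sub>2 \<gamma>\<^sub>1 \<gamma>\<^sub>2 \<gamma>\<^sub>3 \<gamma>\<^sub>4 \<kappa>mdc \<alpha> \<beta>"
    and run: "tr_run \<eta>\<^sub>1 \<eta>\<^sub>2 \<gamma>\<^sub>1 \<gamma>\<^sub>2 \<gamma>\<^sub>3 \<gamma>\<^sub>4 \<kappa>mdc \<alpha> \<beta> f g x \<Delta> B t s"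
    and L: "L \<ge> 1"
      "\<And>k. \<bar>f (x k + s k) - tr_model f g (B k) (x k) (s k)\<bar>
              \<le> 1/2 * (L + opnorm (B k)) * (norm (s k))\<^sup>2"
    and p: "0 < p" "p \<le> 1" and \<mu>: "\<mu> > 0"
    and B_growth: "\<And>k. (MAX j\<in>{..k}. opnorm (B j)) \<le> \<mu> * (1 + real k powr p)"
    and inf_succ: "infinite {k. tr_ratio f g (B k) (x k) (s k) \<ge> \<eta>\<^sub>1}"
    and \<tau>: "\<tau> > 0" "\<gamma>\<^sub>4 * \<gamma>\<^sub>2 ^ (\<tau> - 1) < 1"
    and \<xi>: "\<xi> = (\<Sum>k. (\<gamma>\<^sub>4 * \<gamma>\<^sub>2 ^ (\<tau> - 1)) powr (real k / real \<tau>))"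
    and amin: "amin = 2 * \<gamma>\<^sub>1 * \<kappa>mdc * (1 - \<eta>\<^sub>2) * min 1 (\<Delta> 0 / rpow (norm (g (x 0))) (1 - \<alpha>))"
    and \<kappa>\<^sub>0: "\<kappa>\<^sub>0 = psi L \<beta> (2 * \<mu>) / (\<eta>\<^sub>1 * \<kappa>mdc * amin)"
    and \<kappa>\<^sub>3: "\<kappa>\<^sub>3 = psi L \<beta> (2 * \<mu>) * \<xi>"
    and \<kappa>\<^sub>4: "\<kappa>\<^sub>4 = log \<gamma>\<^sub>2 (amin / \<Delta> 0) + 1"
    and \<delta>: "\<And>k. \<delta> k = f (x k) - flow"
  shows "(p < 1 \<longrightarrow>
       (\<forall>\<^sub>F \<epsilon> in at_right 0. \<forall>k. first_crossing \<delta> \<epsilon> k \<longrightarrow>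
          real k \<le> ((1 - p) * (real \<tau> * R\<^sup>2 * \<kappa>\<^sub>0 / \<epsilon> + \<kappa>\<^sub>3)
                    + ((1 - \<alpha>) * log \<gamma>\<^sub>2 \<epsilon> + \<kappa>\<^sub>4) powr (1 - p)) powr (1 / (1 - p)))
     \<and> (\<lambda>\<epsilon>. ((1 - p) * (real \<tau> * R\<^sup>2 * \<kappa>\<^sub>0 / \<epsilon> + \<kappa>\<^sub>3)
                    + ((1 - \<alpha>) * log \<gamma>\<^sub>2 \<epsilon> + \<kappa>\<^sub>4) powr (1 - p)) powr (1 / (1 - p)))
         \<in> O[at_right 0](\<lambda>\<epsilon>. ((1 - p) / \<epsilon>) powr (1 / (1 - p)))
     \<and> (\<forall>\<epsilon>>0. \<forall>k. first_crossing \<delta> \<epsilon> k \<longrightarrow>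
          real k \<le> ((1 - p) * (real \<tau> * R\<^sup>2 * \<kappa>\<^sub>0 / \<epsilon> + \<kappa>\<^sub>3)
                    + ((1 - \<alpha>) * log \<gamma>\<^sub>2 (\<epsilon> / R) + \<kappa>\<^sub>4) powr (1 - p)) powr (1 / (1 - p))))
   \<and> (p = 1 \<longrightarrow>
       (\<forall>\<^sub>F \<epsilon> in at_right 0. \<forall>k. first_crossing \<delta> \<epsilon> k \<longrightarrow>
          real k \<le> ((1 - \<alpha>) * log \<gamma>\<^sub>2 \<epsilon> + \<kappa>\<^sub>4) * exp (real \<tau> * R\<^sup>2 * \<kappa>\<^sub>0 / \<epsilon> + \<kappa>\<^sub>3))
     \<and> (\<forall>\<epsilon>>0. \<forall>k. first_crossing \<delta> \<epsilon> k \<longrightarrow>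
          real k \<le> ((1 - \<alpha>) * log \<gamma>\<^sub>2 (\<epsilon> / R) + \<kappa>\<^sub>4) * exp (real \<tau> * R\<^sup>2 * \<kappa>\<^sub>0 / \<epsilon> + \<kappa>\<^sub>3)))"
proof -
  define M where "M = (\<lambda>k::nat. \<mu> * (1 + real k powr p))"
  have "mono M"
    using p \<mu> by (auto simp: M_def mono_def intro!: powr_mono2)
  have "opnorm (B k) \<le> M k" for k
  proof -
    have "opnorm (B k) \<le> (MAX j\<in>{..k}. opnorm (B j))"
      by (intro Max_ge) auto
    then show ?thesis
      using B_growth[of k] unfolding M_def by linarith
  qed
  then interpret convex_trust_region_run f g xstar x s \<Delta> t B \<eta>\<^sub>1 \<eta>\<^sub>2 \<gamma>\<^sub>1 \<gamma>\<^sub>2 \<gamma>\<^sub>3 \<gamma>\<^sub>4 \<kappa>mdc \<alpha> \<beta> R L M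
    using gradient convex minimizer R params run L \<open>mono M\<close> by unfold_locales
  let ?\<Psi> = "psi L \<beta> (2 * \<mu>)"
  have "0 < ?\<Psi>"
    using psi_ge[of L "2 * \<mu>" \<beta>] L(1) \<mu> by simp
  have growth: "psi L \<beta> (M k) \<le> ?\<Psi> * real k powr p" if "1 \<le> k" for k
  proof -
    have "1 \<le> real k powr p"
      using that p by (intro ge_one_powr_ge_zero) auto
    moreover from this have "M k \<le> 2 * \<mu> * real k powr p"
      using \<mu> by (simp add: M_def)
    ultimately show ?thesis
      using psi_mono psi_mult_le L(1) by (meson order_trans)
  qed
  have amin_eq: "a_min = amin"
    by (simp add: a_min_def amin)
  have gap_eq: "gap k = \<delta> k" for k
    by (simp add: \<delta> flow)

  \<comment> \<open>The bound at accuracy \<open>\<epsilon>\<close> holds with \<open>y \<epsilon> + D\<close> in place of \<open>y \<epsilon>\<close>, but also with the slack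
     \<open>c\<close> subtracted from \<open>C / \<epsilon> + \<kappa>\<^sub>3\<close>; for small \<open>\<epsilon>\<close> the slack outweighs the shift \<open>D\<close>.\<close>
  define q where "q = 1 - p"
  define C where "C = real \<tau> * R\<^sup>2 * \<kappa>\<^sub>0"
  define c where "c = C / \<delta> 0"
  define y where "y = (\<lambda>\<epsilon>. (1 - \<alpha>) * log \<gamma>\<^sub>2 \<epsilon> + \<kappa>\<^sub>4)"
  define D where "D = (1 - \<alpha>) * log \<gamma>\<^sub>2 (1 / R)"
  have shift: "(1 - \<alpha>) * log \<gamma>\<^sub>2 (\<epsilon> / R) + \<kappa>\<^sub>4 = y \<epsilon> + D" if "0 < \<epsilon>" for \<epsilon>
    using that R(1) by (simp add: y_def D_def log_divide algebra_simps)
  have "0 \<le> D"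
    using R(1) gamma alpha by (simp add: D_def log_def zero_le_mult_iff divide_nonneg_neg mult_nonneg_nonneg ln_div divide_nonpos_neg)
  have "0 \<le> \<kappa>\<^sub>0"
    using \<open>0 < ?\<Psi>\<close> eta kappa a_min_nonneg by (simp add: \<kappa>\<^sub>0 amin_eq)
  have "0 \<le> C"
    using \<open>0 \<le> \<kappa>\<^sub>0\<close> by (simp add: C_def)
  have "0 \<le> \<kappa>\<^sub>3"
    unfolding \<kappa>\<^sub>3 \<xi> using \<open>0 < ?\<Psi>\<close> \<tau> gamma
    by (intro mult_nonneg_nonneg suminf_nonneg summable_powr_divide mult_pos_pos) auto

  have crossing: "0 < c" "\<epsilon> < gap k" if "first_crossing \<delta> \<epsilon> k" "0 < \<epsilon>" for \<epsilon> k
  proof -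
    show "\<epsilon> < gap k"
      using that by (simp add: first_crossing_def gap_eq)
    then have "0 < gap 0"
      using gap_antimono[of 0 k] that by linarith
    then have "0 < a_min"
      using gap_le_grad_norm[of 0] R(1) by (intro a_min_pos) (smt (verit) divide_pos_pos)
    then show "0 < c"
      using \<open>0 < ?\<Psi>\<close> \<open>0 < gap 0\<close> eta kappa \<tau> R(1)
      by (simp add: c_def C_def \<kappa>\<^sub>0 amin_eq gap_eq)
  qed
  have X: "real \<tau> * R\<^sup>2 * (?\<Psi> / (\<eta>\<^sub>1 * \<kappa>mdc * a_min)) * (1 / \<epsilon> - 1 / gap 0)
       + ?\<Psi> * (\<Sum>k. (\<gamma>\<^sub>4 * \<gamma>\<^sub>2 ^ (\<tau> - 1)) powr (real k / real \<tau>)) = C / \<epsilon> + \<kappa>\<^sub>3 - c" for \<epsilon>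
    by (simp add: C_def c_def gap_eq amin_eq \<kappa>\<^sub>0 \<kappa>\<^sub>3 \<xi> right_diff_distrib)
  have k0: "(1 - \<alpha>) * log \<gamma>\<^sub>2 (\<epsilon> / R) + log \<gamma>\<^sub>2 (a_min / \<Delta> 0) + 1 = y \<epsilon> + D" if "0 < \<epsilon>" for \<epsilon>
    using shift[OF that] by (simp add: \<kappa>\<^sub>4 amin_eq)

  have less_1: "real k powr q \<le> q * (C / \<epsilon> + \<kappa>\<^sub>3) - q * c + (y \<epsilon> + D) powr q"
    if "p < 1" "0 < \<epsilon>" "first_crossing \<delta> \<epsilon> k" for \<epsilon> k
    using iteration_bound_of_p_less_1[OF \<tau> \<open>0 < \<epsilon>\<close> crossing(2)[OF that(3,2)] growth \<open>0 < ?\<Psi>\<close>] p that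
    unfolding X k0[OF \<open>0 < \<epsilon>\<close>] q_def by (simp add: right_diff_distrib)
  have eq_1: "real k \<le> (y \<epsilon> + D) * exp (C / \<epsilon> + \<kappa>\<^sub>3 - c)"
    if "p = 1" "0 < \<epsilon>" "first_crossing \<delta> \<epsilon> k" for \<epsilon> k
    using iteration_bound_of_p_eq_1[OF \<tau> \<open>0 < \<epsilon>\<close> crossing(2)[OF that(3,2)] growth \<open>0 < ?\<Psi>\<close>] that
    unfolding X k0[OF \<open>0 < \<epsilon>\<close>] by simp
  have root: "real k \<le> Y powr (1 / q)" if "real k powr q \<le> Y" "p < 1" for k Y
    using powr_mono2[OF _ _ that(1), of "1 / q"] that by (simp add: q_def powr_powr)

  have pos: "eventually (\<lambda>\<epsilon>::real. 0 < \<epsilon>) (at_right 0)"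
    by (simp add: eventually_at_right_less)
  have y_lim: "filterlim y at_top (at_right 0)" if "\<alpha> < 1"
    unfolding y_def using that gamma
    by (intro filterlim_affine_log_at_right_0) auto
  \<comment> \<open>For \<open>\<alpha> = 1\<close> there is no shift; otherwise \<open>y\<close> tends to infinity.\<close>
  have absorb_less_1: "eventually (\<lambda>\<epsilon>. (y \<epsilon> + D) powr q \<le> y \<epsilon> powr q + q * c) (at_right 0)"
    if "0 < c" "p < 1"
  proof (cases "\<alpha> = 1")
    case True
    then show ?thesis using that by (simp add: D_def q_def)
  next
    case False
    then show ?thesis
      using that p alpha \<open>0 \<le> D\<close> y_lim by (intro eventually_powr_add_const_le) (auto simp: q_def)
  qed
  have absorb_eq_1: "eventually (\<lambda>\<epsilon>. y \<epsilon> + D \<le> y \<epsilon> * exp c) (at_right 0)" 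
    if "0 < c" "first_crossing \<delta> \<epsilon>' k" "0 < \<epsilon>'" "p = 1" for \<epsilon>' k
  proof (cases "\<alpha> = 1")
    case True
    then have "y \<epsilon>' + D = \<kappa>\<^sub>4" and *: "D = 0" "\<And>\<epsilon>. y \<epsilon> = \<kappa>\<^sub>4"
      by (simp_all add: y_def D_def)
    \<comment> \<open>The sign of \<open>\<kappa>\<^sub>4\<close> is read off from the bound at any one crossing.\<close>
    then have "0 \<le> \<kappa>\<^sub>4 * exp (C / \<epsilon>' + \<kappa>\<^sub>3 - c)"
      using eq_1[OF \<open>p = 1\<close> \<open>0 < \<epsilon>'\<close> that(2)] by (metis of_nat_0_le_iff order_trans)
    then have "0 \<le> \<kappa>\<^sub>4"
      by (simp add: zero_le_mult_iff)
    then have "\<kappa>\<^sub>4 * 1 \<le> \<kappa>\<^sub>4 * exp c"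
      using \<open>0 < c\<close> by (intro mult_left_mono) auto
    then show ?thesis by (simp add: *)
  next
    case False
    then show ?thesis
      using that alpha y_lim by (intro eventually_add_const_le_mult_exp) auto
  qed
  show ?thesis
  proof (intro conjI impI allI)
    show "\<forall>\<^sub>F \<epsilon> in at_right 0. \<forall>k. first_crossing \<delta> \<epsilon> k \<longrightarrow>
        real k \<le> ((1 - p) * (real \<tau> * R\<^sup>2 * \<kappa>\<^sub>0 / \<epsilon> + \<kappa>\<^sub>3)
          + ((1 - \<alpha>) * log \<gamma>\<^sub>2 \<epsilon> + \<kappa>\<^sub>4) powr (1 - p)) powr (1 / (1 - p))" if "p < 1"
    proof (cases "0 < c")
      case True
      show ?thesis
        using absorb_less_1[OF True that] pos
      proof eventually_elim
        case (elim \<epsilon>)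
        have "real k powr q \<le> q * (C / \<epsilon> + \<kappa>\<^sub>3) + y \<epsilon> powr q" if "first_crossing \<delta> \<epsilon> k" for k
          using less_1[OF \<open>p < 1\<close> elim(2) that] elim(1) by linarith
        then show ?case
          using root \<open>p < 1\<close> unfolding q_def C_def y_def by blast
      qed
    qed (use pos crossing(1) in \<open>auto elim!: eventually_mono\<close>)
    show "real k \<le> ((1 - p) * (real \<tau> * R\<^sup>2 * \<kappa>\<^sub>0 / \<epsilon> + \<kappa>\<^sub>3)
          + ((1 - \<alpha>) * log \<gamma>\<^sub>2 (\<epsilon> / R) + \<kappa>\<^sub>4) powr (1 - p)) powr (1 / (1 - p))"
      if "p < 1" "0 < \<epsilon>" "first_crossing \<delta> \<epsilon> k" for \<epsilon> k
    proof -
      have "0 \<le> q * c"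
        using crossing(1)[OF that(3,2)] that by (simp add: q_def)
      then have "real k powr q \<le> q * (C / \<epsilon> + \<kappa>\<^sub>3) + (y \<epsilon> + D) powr q"
        using less_1[OF that] by linarith
      then show ?thesis
        using root \<open>p < 1\<close> unfolding shift[OF \<open>0 < \<epsilon>\<close>] q_def C_def by blast
    qed
    show "(\<lambda>\<epsilon>. ((1 - p) * (real \<tau> * R\<^sup>2 * \<kappa>\<^sub>0 / \<epsilon> + \<kappa>\<^sub>3)
          + ((1 - \<alpha>) * log \<gamma>\<^sub>2 \<epsilon> + \<kappa>\<^sub>4) powr (1 - p)) powr (1 / (1 - p)))
        \<in> O[at_right 0](\<lambda>\<epsilon>. ((1 - p) / \<epsilon>) powr (1 / (1 - p)))" if "p < 1"
      using \<open>0 \<le> C\<close> \<open>0 \<le> \<kappa>\<^sub>3\<close> p that gamma alpha unfolding C_def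
      by (intro iteration_bound_bigo) auto
    show "\<forall>\<^sub>F \<epsilon> in at_right 0. \<forall>k. first_crossing \<delta> \<epsilon> k \<longrightarrow>
        real k \<le> ((1 - \<alpha>) * log \<gamma>\<^sub>2 \<epsilon> + \<kappa>\<^sub>4) * exp (real \<tau> * R\<^sup>2 * \<kappa>\<^sub>0 / \<epsilon> + \<kappa>\<^sub>3)"
      if "p = 1"
    proof (cases "\<exists>\<epsilon> k. 0 < \<epsilon> \<and> first_crossing \<delta> \<epsilon> k")
      case True
      then obtain \<epsilon>' k' where *: "first_crossing \<delta> \<epsilon>' k'" "0 < \<epsilon>'" by blast
      show ?thesis
        using absorb_eq_1[OF crossing(1)[OF *] * that] pos
      proof eventually_elim
        case (elim \<epsilon>)
        have "real k \<le> y \<epsilon> * exp (C / \<epsilon> + \<kappa>\<^sub>3)" if "first_crossing \<delta> \<epsilon> k" for k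
        proof -
          have "real k \<le> (y \<epsilon> + D) * exp (C / \<epsilon> + \<kappa>\<^sub>3 - c)"
            using eq_1 \<open>p = 1\<close> elim(2) that by blast
          also have "\<dots> \<le> y \<epsilon> * exp c * exp (C / \<epsilon> + \<kappa>\<^sub>3 - c)"
            using elim(1) by (intro mult_right_mono) auto
          also have "\<dots> = y \<epsilon> * exp (C / \<epsilon> + \<kappa>\<^sub>3)"
            by (simp add: mult.assoc flip: exp_add)
          finally show ?thesis .
        qed
        then show ?case
          unfolding C_def y_def by blast
      qed
    qed (use pos in \<open>auto elim!: eventually_mono\<close>)
    show "real k \<le> ((1 - \<alpha>) * log \<gamma>\<^sub>2 (\<epsilon> / R) + \<kappa>\<^sub>4) * exp (real \<tau> * R\<^sup>2 * \<kappa>\<^sub>0 / \<epsilon> + \<kappa>\<^sub>3)"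
      if "p = 1" "0 < \<epsilon>" "first_crossing \<delta> \<epsilon> k" for \<epsilon> k
    proof -
      have k: "real k \<le> (y \<epsilon> + D) * exp (C / \<epsilon> + \<kappa>\<^sub>3 - c)"
        by (rule eq_1[OF that])
      then have "0 \<le> (y \<epsilon> + D) * exp (C / \<epsilon> + \<kappa>\<^sub>3 - c)"
        by (rule order_trans[OF of_nat_0_le_iff])
      then have "0 \<le> y \<epsilon> + D"
        by (simp add: zero_le_mult_iff)
      then have "(y \<epsilon> + D) * exp (C / \<epsilon> + \<kappa>\<^sub>3 - c) \<le> (y \<epsilon> + D) * exp (C / \<epsilon> + \<kappa>\<^sub>3)"
        using crossing(1)[OF that(3,2)] by (intro mult_left_mono) auto
      then show ?thesis
        using k unfolding shift[OF \<open>0 < \<epsilon>\<close>] C_def by linarith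
    qed
  qed
qed

end
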